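(* Let $E\subset\mathbb{T}$ be a nonempty closed set such that $I(\alpha,E)=+\infty$ for some $\alpha\ge 0$. Let $q>0$ with $q\ge\alpha$, and let $\mu_0$ be the Riesz measure of the subharmonic function $v_0(z)=\rho^{-q}(z,E)$ on $\mathbb{D}$. Then $$\int_{\mathbb{D}}(1-|\lambda|)\,\bigl(\rho(\lambda,E)\bigr)^{q-\alpha}\,d\mu_0(\lambda)=+\infty.$$
   Context: $\mathbb{D}=\{z\in\mathbb{C}:|z|<1\}$ is the open unit disk and $\mathbb{T}=\{z\in\mathbb{C}:|z|=1\}$ the unit circle. For a closed set $E\subset\mathbb{T}$, $\rho(z,E)=\mathrm{dist}(z,E)$ is the Euclidean distance from $z$ to $E$, and $\rho^{-q}(z,E)=(\rho(z,E))^{-q}$; the function $\rho^{-q}(\cdot,E)$ is subharmonic in $\mathbb{D}$, being the supremum over $\zeta\in E$ of $|z-\zeta|^{-q}$. For $t>0$ put $E_t=\{\zeta\in\mathbb{T}:\rho(\zeta,E)<t\}$ and $\nu_E(t)=|E_t|$, where $|A|$ denotes the normalized Lebesgue measure of $A\subset\mathbb{T}$ (so $|\mathbb{T}|=1$). For $\alpha\in\mathbb{R}$, $$I(\alpha,E)=\int_0^2\frac{\nu_E(s)}{s^{\alpha+1}}\,ds\in[0,+\infty].$$ The Riesz measure of a subharmonic function $v\not\equiv-\infty$ on $\mathbb{D}$ is the positive Radon measure $\mu=\frac{1}{2\pi}\triangle v$ on $\mathbb{D}$, the Laplacian being taken in the sense of distributions. *)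

theory Defs
  imports "HOL-Analysis.Analysis"
begin

abbreviation unit_disc :: "complex set" ("\<D>")
  where "\<D> \<equiv> ball 0 1"

abbreviation unit_circle :: "complex set" ("\<T>")
  where "\<T> \<equiv> sphere 0 1"

text \<open>Normalized arc length of a subset of the unit circle, computed in the angular
  coordinate, so that the whole circle has measure 1.\<close>

definition circle_measure :: "complex set \<Rightarrow> real"
  where "circle_measure A = measure lebesgue {\<theta>\<in>{0..<2 * pi}. cis \<theta> \<in> A} / (2 * pi)"

definition circle_nbhd :: "complex set \<Rightarrow> real \<Rightarrow> complex set"
  where "circle_nbhd E t = {\<zeta>\<in>\<T>. infdist \<zeta> E < t}"

definition nu :: "complex set \<Rightarrow> real \<Rightarrow> real"
  where "nu E t = circle_measure (circle_nbhd E t)"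

definition I_int :: "real \<Rightarrow> complex set \<Rightarrow> ennreal"
  where "I_int \<alpha> E = (\<integral>\<^sup>+s\<in>{0<..2}. ennreal (nu E s / s powr (\<alpha> + 1)) \<partial>lborel)"

text \<open>The plane is identified with the complex numbers; the directions \<open>1\<close> and \<open>\<i>\<close> give
  the partial derivatives in \<open>x\<close> and \<open>y\<close>.\<close>

definition partial :: "complex \<Rightarrow> (complex \<Rightarrow> real) \<Rightarrow> complex \<Rightarrow> real"
  where "partial e f z = frechet_derivative f (at z) e"

definition laplacian :: "(complex \<Rightarrow> real) \<Rightarrow> complex \<Rightarrow> real"
  where "laplacian f z = partial 1 (partial 1 f) z + partial \<i> (partial \<i> f) z"

fun C_k :: "nat \<Rightarrow> (complex \<Rightarrow> real) \<Rightarrow> bool" where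
  "C_k 0 f \<longleftrightarrow> continuous_on UNIV f"
| "C_k (Suc k) f \<longleftrightarrow>
     (\<forall>z. f differentiable (at z)) \<and> C_k k (partial 1 f) \<and> C_k k (partial \<i> f)"

text \<open>Compactly supported smooth functions on an open set \<open>\<Omega>\<close>, extended by zero to the
  whole plane.\<close>

definition test_function :: "complex set \<Rightarrow> (complex \<Rightarrow> real) \<Rightarrow> bool"
  where "test_function \<Omega> \<phi> \<longleftrightarrow>
    (\<forall>k. C_k k \<phi>) \<and> compact (closure {z. \<phi> z \<noteq> 0}) \<and> closure {z. \<phi> z \<noteq> 0} \<subseteq> \<Omega>"

text \<open>\<open>\<mu>\<close> is a Radon measure on the disc (a Borel measure finite on compact sets, which on
  the disc is automatically regular) and equals the distributional Laplacian of \<open>v\<close> divided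
  by \<open>2\<pi>\<close>. Local integrability of \<open>v\<close>, which holds for every subharmonic function that is not
  identically \<open>-\<infinity>\<close>, makes the pairing with \<open>laplacian \<phi>\<close> meaningful.\<close>

definition is_Riesz_measure :: "(complex \<Rightarrow> real) \<Rightarrow> complex measure \<Rightarrow> bool"
  where "is_Riesz_measure v \<mu> \<longleftrightarrow>
    (\<forall>K. compact K \<and> K \<subseteq> \<D> \<longrightarrow> set_integrable lborel K v) \<and>
    sets \<mu> = sets (restrict_space borel \<D>) \<and>
    (\<forall>K. compact K \<and> K \<subseteq> \<D> \<longrightarrow> emeasure \<mu> K < \<infinity>) \<and>
    (\<forall>\<phi>. test_function \<D> \<phi> \<longrightarrow>
      (\<integral>z. \<phi> z \<partial>\<mu>) = 1 / (2 * pi) * (LINT z:\<D>|lborel. v z * laplacian \<phi> z))"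

end

theory Submission
  imports Defs
begin

text \<open>
  Write \<open>v = \<rho>\<^sup>-\<^sup>q\<close>. If \<open>\<zeta>\<close> is a point of \<open>E\<close> nearest to \<open>z\<close>, then \<open>v\<close> dominates
  \<open>|\<cdot> - \<zeta>|\<^sup>-\<^sup>q\<close> with equality at \<open>z\<close>, so the second difference of \<open>v\<close> at \<open>z\<close> is at least that
  of \<open>|\<cdot> - \<zeta>|\<^sup>-\<^sup>q\<close>. Moving second differences onto test functions gives
  \<open>\<Delta>v \<ge> c \<rho>\<^sup>-\<^sup>q\<^sup>-\<^sup>2\<close> as distributions, for a constant \<open>c > 0\<close>, and hence bounds the integral of
  the theorem below by a multiple of the area integral of \<open>(1 - |z|) \<rho>\<^sup>-\<^sup>\<alpha>\<^sup>-\<^sup>2\<close>.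
  As \<open>\<rho>(r\<zeta>) \<le> 2 (1 - r)\<close> whenever \<open>\<rho>(\<zeta>) < 1 - r\<close>, integrating over circles bounds that area
  integral from below by a multiple of the integral of \<open>\<nu>\<^sub>E(s) s\<^sup>-\<^sup>\<alpha>\<^sup>-\<^sup>1\<close> near \<open>0\<close>.
\<close>

section \<open>Smooth bumps\<close>

lemma partial_eqI:
  assumes "(f has_derivative f') (at z)"
  shows "partial e f z = f' e"
  using frechet_derivative_at[OF assms] by (simp add: partial_def)

lemma has_derivative_partial:
  assumes "f differentiable (at z)"
  shows "(f has_derivative (\<lambda>e. partial e f z)) (at z)"
  using assms unfolding partial_def by (simp add: frechet_derivative_works)

lemma C_k_Suc_imp_C_k: "C_k (Suc k) f \<Longrightarrow> C_k k f"
proof (induction k arbitrary: f)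
  case 0
  then show ?case
    by (auto simp: continuous_on_eq_continuous_at differentiable_imp_continuous_within)
next
  case (Suc k)
  then show ?case by (metis C_k.simps(2))
qed

lemma C_k_const: "C_k k (\<lambda>z. c)"
proof (induction k arbitrary: c)
  case (Suc k)
  have "partial e (\<lambda>z. c) = (\<lambda>z. 0)" for e
    by (rule ext, rule partial_eqI) (rule has_derivative_const)
  with Suc show ?case by simp
qed simp

lemma C_k_bounded_linear:
  assumes "bounded_linear f"
  shows "C_k k f"
proof (cases k)
  case 0
  then show ?thesis
    using assms by (simp add: linear_continuous_on)
next
  case (Suc n)
  have "partial e f = (\<lambda>z. f e)" for e
    by (rule ext, rule partial_eqI) (rule bounded_linear_imp_has_derivative[OF assms])
  with Suc show ?thesis
    using assms by (auto simp: C_k_const bounded_linear_imp_differentiable)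
qed

lemma C_k_add: "C_k k f \<Longrightarrow> C_k k g \<Longrightarrow> C_k k (\<lambda>z. f z + g z)"
proof (induction k arbitrary: f g)
  case 0
  then show ?case by (auto intro: continuous_intros)
next
  case (Suc k)
  have "partial e (\<lambda>z. f z + g z) = (\<lambda>z. partial e f z + partial e g z)" for e
    using Suc.prems
    by (intro ext partial_eqI has_derivative_add has_derivative_partial) auto
  with Suc show ?case by (auto intro: differentiable_add)
qed

lemma C_k_mult: "C_k k f \<Longrightarrow> C_k k g \<Longrightarrow> C_k k (\<lambda>z. f z * g z)"
proof (induction k arbitrary: f g)
  case 0
  then show ?case by (auto intro: continuous_intros)
next
  case (Suc k)
  have eq: "partial e (\<lambda>z. f z * g z) = (\<lambda>z. f z * partial e g z + partial e f z * g z)" for e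
    using Suc.prems
    by (intro ext partial_eqI has_derivative_mult has_derivative_partial) auto
  have "C_k k f" "C_k k g"
    using Suc.prems C_k_Suc_imp_C_k by blast+
  with Suc show ?case by (auto simp: eq intro!: differentiable_mult C_k_add)
qed

lemma C_k_polynomial: "real_polynomial_function p \<Longrightarrow> C_k k p"
proof (induction rule: real_polynomial_function.induct)
  case (mult f g)
  then show ?case by (intro C_k_mult)
qed (auto intro: C_k_bounded_linear C_k_const C_k_add)

text \<open>The index m closes the family under differentiation: every derivative of exp (- 1 / t),
  extended by 0 to t \<le> 0, is a linear combination of these functions. Smoothness then follows by
  induction on the order, with m arbitrary.\<close>

definition flat :: "nat \<Rightarrow> real \<Rightarrow> real"
  where "flat m t = (if t \<le> 0 then 0 else exp (- 1 / t) / t ^ m)"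

lemma flat_nonneg: "0 \<le> flat m t"
  by (simp add: flat_def)

text \<open>Keeping only the term of index m + 2 in the series of exp (1 / t) gives the bound. The
  surplus factor t^2 is what makes the derivative at 0 vanish in \<open>DERIV_flat\<close>.\<close>

lemma flat_le: "flat m t \<le> fact (m + 2) * t\<^sup>2"
proof (cases "t \<le> 0")
  case False
  have "(\<Sum>n\<in>{m + 2}. (1 / t) ^ n /\<^sub>R fact n) \<le> (\<Sum>n. (1 / t) ^ n /\<^sub>R fact n)"
    by (rule sum_le_suminf[OF summable_exp_generic]) (use False in auto)
  then have "1 / (t ^ (m + 2) * fact (m + 2)) \<le> exp (1 / t)"
    unfolding exp_def by (simp add: power_one_over inverse_eq_divide mult_ac del: fact_Suc power_Suc)
  then have "exp (- 1 / t) \<le> t ^ (m + 2) * fact (m + 2)"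
    using False by (simp add: exp_minus field_simps del: fact_Suc power_Suc)
  then have "exp (- 1 / t) / t ^ m \<le> t ^ (m + 2) * fact (m + 2) / t ^ m"
    using False by (intro divide_right_mono) auto
  also have "\<dots> = fact (m + 2) * t\<^sup>2"
    using False by (simp add: power_add power2_eq_square del: fact_Suc)
  finally show ?thesis
    using False by (simp add: flat_def)
qed (simp add: flat_def)

lemma DERIV_flat:
  "(flat m has_real_derivative (flat (m + 2) t - real m * flat (m + 1) t)) (at t)"
proof -
  consider "t < 0" | "t = 0" | "t > 0" by linarith
  then show ?thesis
  proof cases
    case 1
    have "((\<lambda>_. 0) has_real_derivative 0) (at t)" by simp
    then have "(flat m has_real_derivative 0) (at t)"
      by (rule has_field_derivative_transform_within_open[where S="{..<0}"])
         (use 1 in \<open>auto simp: flat_def\<close>)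
    with 1 show ?thesis by (simp add: flat_def)
  next
    case 2
    have "((\<lambda>h. flat m h / h) \<longlongrightarrow> 0) (at 0)"
    proof (rule Lim_null_comparison)
      show "\<forall>\<^sub>F h in at 0. norm (flat m h / h) \<le> fact (m + 2) * \<bar>h\<bar>"
      proof (intro always_eventually allI)
        fix h :: real
        have "norm (flat m h / h) \<le> fact (m + 2) * h\<^sup>2 / \<bar>h\<bar>"
          using flat_le[of m h] flat_nonneg[of m h]
          by (simp add: divide_right_mono del: fact_Suc)
        also have "\<dots> = fact (m + 2) * \<bar>h\<bar>"
          by (cases "h = 0") (simp_all add: power2_eq_square abs_if)
        finally show "norm (flat m h / h) \<le> fact (m + 2) * \<bar>h\<bar>" .
      qed
      show "((\<lambda>h::real. fact (m + 2) * \<bar>h\<bar>) \<longlongrightarrow> 0) (at 0)"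
        by (auto intro!: tendsto_eq_intros)
    qed
    with 2 show ?thesis
      by (simp add: DERIV_def flat_def[of _ 0])
  next
    case 3
    have "((\<lambda>t. exp (- 1 / t) / t ^ m) has_real_derivative
            (flat (m + 2) t - real m * flat (m + 1) t)) (at t)"
      using 3
      by (cases m)
         (auto intro!: derivative_eq_intros simp: flat_def field_simps power2_eq_square,
          metis One_nat_def power_eq_if)
    then show ?thesis
      by (rule has_field_derivative_transform_within_open[where S="{0<..}"])
         (use 3 in \<open>auto simp: flat_def\<close>)
  qed
qed

lemma C_k_flat_compose:
  assumes P: "\<And>k. C_k k P"
  shows "C_k k (\<lambda>z. flat m (P z))"
proof (induction k arbitrary: m)
  case 0
  have "continuous_on UNIV (flat m)"
    using DERIV_flat[of m] DERIV_isCont by (metis continuous_at_imp_continuous_on)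
  moreover have "continuous_on UNIV P"
    using P[of 0] by simp
  ultimately show ?case
    by (auto intro: continuous_on_compose2)
next
  case (Suc k)
  have d: "((\<lambda>z. flat m (P z)) has_derivative
      (\<lambda>e. (flat (m + 2) (P z) - real m * flat (m + 1) (P z)) * partial e P z)) (at z)" for z
    using has_derivative_compose[OF has_derivative_partial, of P z "flat m"]
      DERIV_flat[of m "P z"] P[of "Suc 0"]
    by (auto simp: has_field_derivative_def)
  have eq: "partial e (\<lambda>z. flat m (P z)) =
      (\<lambda>z. (flat (m + 2) (P z) + (- real m) * flat (m + 1) (P z)) * partial e P z)" for e
    by (rule ext) (simp add: partial_eqI[OF d])
  have "C_k k (partial 1 P)" "C_k k (partial \<i> P)"
    using P[of "Suc k"] by auto
  with Suc d show ?case
    unfolding C_k.simps eq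
    by (intro conjI allI C_k_mult C_k_add C_k_const) (auto simp: differentiable_def)
qed

text \<open>The radial factor supplies the compact support. The polynomial p is left free so that it
  can approximate a given weight, and N so that the radial factor can be bounded below on a smaller
  disc.\<close>

lemma test_function_bump:
  assumes "0 < R" "R < 1" "real_polynomial_function p" "0 < N"
  shows "test_function \<D> (\<lambda>z. flat 0 (N * (R\<^sup>2 - (norm z)\<^sup>2)) * p z)" (is "test_function _ ?\<phi>")
    and "closure {z. flat 0 (N * (R\<^sup>2 - (norm z)\<^sup>2)) * p z \<noteq> 0} \<subseteq> cball 0 R"
proof -
  have "{z. ?\<phi> z \<noteq> 0} \<subseteq> cball 0 R"
  proof (clarsimp simp: flat_def split: if_splits)
    fix z :: complex assume "\<not> N * (R\<^sup>2 - (cmod z)\<^sup>2) \<le> 0"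
    then have "(norm z)\<^sup>2 < R\<^sup>2" using \<open>0 < N\<close>
      by (simp add: mult_le_0_iff)
    then show "cmod z \<le> R" using \<open>0 < R\<close>
      by (smt (verit) power_mono)
  qed
  then show sub: "closure {z. ?\<phi> z \<noteq> 0} \<subseteq> cball 0 R"
    by (rule closure_minimal) simp
  have "real_polynomial_function (\<lambda>z::complex. N * (R\<^sup>2 - (norm z)\<^sup>2))"
    unfolding cmod_power2
    by (intro real_polynomial_function.intros real_polynomial_function_diff
        real_polynomial_function_power bounded_linear_Re bounded_linear_Im)
  then have "C_k k ?\<phi>" for k
    by (intro C_k_mult C_k_flat_compose C_k_polynomial assms)
  moreover have "compact (closure {z. ?\<phi> z \<noteq> 0})"
    unfolding compact_eq_bounded_closed
    using bounded_subset[OF bounded_cball sub] by simp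
  moreover have "cball 0 R \<subseteq> \<D>" using assms by auto
  ultimately show "test_function \<D> ?\<phi>"
    unfolding test_function_def using sub by blast
qed

section \<open>Second differences of the distance power\<close>

text \<open>Convexity of the negative power. With u = y / x it comes down to ln u \<le> u - 1,
  followed by 1 + v \<le> exp v.\<close>

lemma powr_neg_above_tangent:
  fixes x y m :: real
  assumes "x > 0" "y > 0" "m > 0"
  shows "x powr (- m) - m * x powr (- m - 1) * (y - x) \<le> y powr (- m)"
proof -
  have "1 - m * (y / x - 1) \<le> 1 + - m * ln (y / x)"
    using assms ln_le_minus_one[of "y / x"] by (simp add: mult_left_mono)
  also have "\<dots> \<le> exp (- m * ln (y / x))"
    by (rule exp_ge_add_one_self)
  also have "\<dots> = (y / x) powr (- m)"
    using assms by (simp add: powr_def)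
  finally have "x powr (- m) * (1 - m * (y / x - 1)) \<le> x powr (- m) * (y / x) powr (- m)"
    by (intro mult_left_mono) auto
  also have "\<dots> = y powr (- m)"
    using assms by (simp add: powr_divide)
  finally show ?thesis
    using assms by (simp add: powr_diff field_simps)
qed

text \<open>The right side minus the quadratic term has derivative 0 at b = 0, and its second
  derivative is nonnegative by convexity of the power with exponent - p - 2. It therefore increases
  from its value at b = 0; negative b follow by symmetry.\<close>

lemma powr_second_difference:
  fixes a b p :: real
  assumes p: "p > 0" and ab: "\<bar>b\<bar> < a"
  shows "2 * a powr (- p) + p * (p + 1) * a powr (- p - 2) * b\<^sup>2
    \<le> (a + b) powr (- p) + (a - b) powr (- p)"
proof -
  have *: "2 * a powr (- p) + p * (p + 1) * a powr (- p - 2) * b\<^sup>2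
    \<le> (a + b) powr (- p) + (a - b) powr (- p)" if b: "0 \<le> b" "b < a" for b
  proof -
    define G where "G x = (a + x) powr (- p) + (a - x) powr (- p)
      - p * (p + 1) * a powr (- p - 2) * x\<^sup>2" for x
    define G' where "G' x = - p * (a + x) powr (- p - 1) + p * (a - x) powr (- p - 1)
      - p * (p + 1) * a powr (- p - 2) * (2 * x)" for x
    define G'' where "G'' x = p * (p + 1) * ((a + x) powr (- p - 2) + (a - x) powr (- p - 2)
      - 2 * a powr (- p - 2))" for x
    have G: "(G has_real_derivative G' x) (at x)" if "0 \<le> x" "x \<le> b" for x
      unfolding G_def G'_def using that b
      by (auto intro!: derivative_eq_intros simp: algebra_simps)
    have G': "(G' has_real_derivative G'' x) (at x)" if "0 \<le> x" "x \<le> b" for x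
      unfolding G'_def G''_def using that b
      by (auto intro!: derivative_eq_intros simp: algebra_simps)
    have G'': "0 \<le> G'' x" if "0 \<le> x" "x \<le> b" for x
    proof -
      have "2 * a powr (- p - 2) \<le> (a + x) powr (- p - 2) + (a - x) powr (- p - 2)"
        using powr_neg_above_tangent[of a "a + x" "p + 2"]
          powr_neg_above_tangent[of a "a - x" "p + 2"] that b p
        by (simp add: algebra_simps)
      then show ?thesis using p by (simp add: G''_def)
    qed
    have "G' 0 \<le> G' x" if "0 \<le> x" "x \<le> b" for x
      by (rule DERIV_nonneg_imp_nondecreasing[OF that(1)]) (use G' G'' that in force)
    then have "0 \<le> G' x" if "0 \<le> x" "x \<le> b" for x
      using that by (simp add: G'_def)
    then have "G 0 \<le> G b"
      by (intro DERIV_nonneg_imp_nondecreasing[OF b(1)]) (use G in force)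
    then show ?thesis by (simp add: G_def)
  qed
  show ?thesis
    using *[of "\<bar>b\<bar>"] ab by (cases "b \<ge> 0") (auto simp: add.commute)
qed

text \<open>With a = |w|^2 + h^2 the four squared norms are a + b and a - b for b = 2 h Re w and b =
  2 h Im w. So \<open>powr_second_difference\<close> applies twice with exponent q / 2, and the two
  values of b^2 add up to 4 h^2 |w|^2. The tangent inequality then compares the power of a with that
  of |w|^2. To leading order the bound is h^2 q^2 |w|^(- q - 2), which is h^2 times the Laplacian of
  |w|^(- q).\<close>

lemma norm_powr_second_difference:
  fixes w :: complex and h q :: real
  assumes q: "q > 0" and h: "0 < h" "h < norm w"
  shows "norm (w + h) powr (- q) + norm (w - h) powr (- q)
      + norm (w + \<i> * h) powr (- q) + norm (w - \<i> * h) powr (- q) - 4 * norm w powr (- q)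
    \<ge> h\<^sup>2 * (q * (q + 2) * ((norm w)\<^sup>2 + h\<^sup>2) powr (- q / 2 - 2) * (norm w)\<^sup>2
        - 2 * q * norm w powr (- q - 2))"
proof -
  define p where "p = q / 2"
  define a where "a = (norm w)\<^sup>2 + h\<^sup>2"
  have p: "p > 0" using q by (simp add: p_def)
  have pw: "norm z powr (- q) = ((norm z)\<^sup>2) powr (- p)" for z :: complex
    by (cases "z = 0") (simp_all add: p_def powr_powr flip: powr_numeral)
  have w: "norm w > 0" using h by linarith
  have a: "a > 0" using w by (simp add: a_def add_pos_nonneg)
  have gap: "2 * h * norm w < a"
  proof -
    have "(norm w - h)\<^sup>2 > 0" using h by simp
    then show ?thesis by (simp add: a_def power2_diff algebra_simps)
  qed
  have b: "\<bar>2 * h * Re w\<bar> < a" "\<bar>2 * h * Im w\<bar> < a"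
    using gap h(1) abs_Re_le_cmod[of w] abs_Im_le_cmod[of w]
    by (auto simp: abs_mult intro: le_less_trans[rotated])
  have sq: "(norm (w + h))\<^sup>2 = a + 2 * h * Re w" "(norm (w - h))\<^sup>2 = a - 2 * h * Re w"
     "(norm (w + \<i> * h))\<^sup>2 = a + 2 * h * Im w" "(norm (w - \<i> * h))\<^sup>2 = a - 2 * h * Im w"
    unfolding a_def cmod_power2 by (simp_all add: power2_eq_square algebra_simps)
  have split: "p * (p + 1) * a powr (- p - 2) * (4 * h\<^sup>2 * (norm w)\<^sup>2)
    = p * (p + 1) * a powr (- p - 2) * (2 * h * Re w)\<^sup>2
      + p * (p + 1) * a powr (- p - 2) * (2 * h * Im w)\<^sup>2"
    by (simp add: cmod_power2 power_mult_distrib algebra_simps)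
  have 1: "norm (w + h) powr (- q) + norm (w - h) powr (- q)
      + norm (w + \<i> * h) powr (- q) + norm (w - \<i> * h) powr (- q)
    \<ge> 4 * a powr (- p) + p * (p + 1) * a powr (- p - 2) * (4 * h\<^sup>2 * (norm w)\<^sup>2)"
    unfolding pw sq split
    using powr_second_difference[OF p b(1)] powr_second_difference[OF p b(2)] by linarith
  have 2: "a powr (- p) \<ge> ((norm w)\<^sup>2) powr (- p) - p * h\<^sup>2 * ((norm w)\<^sup>2) powr (- p - 1)"
    using powr_neg_above_tangent[of "(norm w)\<^sup>2" a p] w p a by (simp add: a_def mult_ac)
  have 3: "((norm w)\<^sup>2) powr (- p - 1) = norm w powr (- q - 2)"
    using w by (simp add: p_def powr_powr algebra_simps flip: powr_numeral)
  have q2: "q = 2 * p" by (simp add: p_def)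
  have "h\<^sup>2 * (q * (q + 2) * a powr (- q / 2 - 2) * (norm w)\<^sup>2 - 2 * q * norm w powr (- q - 2))
    = p * (p + 1) * a powr (- p - 2) * (4 * h\<^sup>2 * (norm w)\<^sup>2)
      - 4 * (p * h\<^sup>2 * ((norm w)\<^sup>2) powr (- p - 1))"
    unfolding 3 by (simp add: q2 algebra_simps)
  then show ?thesis
    using 1 2 pw[of w] unfolding a_def by linarith
qed

text \<open>The five-point discrete Laplacian, without its factor 1 / h^2.\<close>

definition second_diff :: "real \<Rightarrow> (complex \<Rightarrow> real) \<Rightarrow> complex \<Rightarrow> real"
  where "second_diff h f z = f (z + h) + f (z - h) + f (z + \<i> * h) + f (z - \<i> * h) - 4 * f z"

text \<open>As the ratio of h to the distance tends to 0, the constant for the touching power tends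
  to q (q + 2) - 2 q = q^2. After scaling, this ratio is the only parameter left, so asking for q^2
  / 2 leaves room for one \<epsilon> that serves all z.\<close>

lemma second_diff_infdist_powr:
  fixes E :: "complex set" and q :: real
  assumes E: "closed E" "E \<noteq> {}" and q: "q > 0"
  obtains \<epsilon> where "\<epsilon> > 0" and
    "\<And>z h. 0 < h \<Longrightarrow> h \<le> \<epsilon> * infdist z E \<Longrightarrow>
      q\<^sup>2 / 2 * h\<^sup>2 * infdist z E powr (- q - 2) \<le> second_diff h (\<lambda>z. infdist z E powr (- q)) z"
proof -
  have "((\<lambda>t. q * (q + 2) * (1 + t\<^sup>2) powr (- q / 2 - 2) - 2 * q) \<longlongrightarrow>
      q * (q + 2) * (1 + 0\<^sup>2) powr (- q / 2 - 2) - 2 * q) (at_right 0)"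
    by (intro tendsto_intros) auto
  moreover have "q\<^sup>2 / 2 < q * (q + 2) * (1 + 0\<^sup>2) powr (- q / 2 - 2) - 2 * q"
    using q by (simp add: power2_eq_square algebra_simps)
  ultimately have "\<forall>\<^sub>F t in at_right 0. q\<^sup>2 / 2 < q * (q + 2) * (1 + t\<^sup>2) powr (- q / 2 - 2) - 2 * q"
    by (rule order_tendstoD(1))
  then obtain b where b: "b > 0"
    "\<And>t. 0 < t \<Longrightarrow> t < b \<Longrightarrow> q\<^sup>2 / 2 < q * (q + 2) * (1 + t\<^sup>2) powr (- q / 2 - 2) - 2 * q"
    by (auto simp: eventually_at_right_field)
  \<comment> \<open>The bound 1 / 2 keeps h below the distance, so that the four neighbours of z
    stay off E; b / 2 keeps \<epsilon> in the range just found.\<close>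
  define \<epsilon> where "\<epsilon> = min (b / 2) (1 / 2)"
  have \<epsilon>: "0 < \<epsilon>" "\<epsilon> < 1" "q\<^sup>2 / 2 < q * (q + 2) * (1 + \<epsilon>\<^sup>2) powr (- q / 2 - 2) - 2 * q"
    using b by (auto simp: \<epsilon>_def)
  show thesis
  proof (rule that[OF \<epsilon>(1)])
    fix z h assume h: "0 < h" "h \<le> \<epsilon> * infdist z E"
    obtain \<zeta> where \<zeta>: "\<zeta> \<in> E" "infdist z E = dist z \<zeta>"
      using infdist_attains_inf[OF E] by blast
    define r where "r = infdist z E"
    have r: "r > 0"
      using h \<epsilon> unfolding r_def by (smt (verit) mult_nonneg_nonpos)
    have hr: "h < r"
      using h(2) r \<epsilon>(2) unfolding r_def[symmetric]
      by (smt (verit) mult_less_cancel_right2)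
    have r': "r = norm (z - \<zeta>)"
      using \<zeta> by (simp add: r_def dist_norm)
    \<comment> \<open>The point \<zeta> still competes for the distance at z + d, and the negative
      exponent reverses the inequality. The distance at z + d has to be positive for this, as
      \<open>0 powr x\<close> is 0.\<close>
    have shift: "norm (z - \<zeta> + d) powr (- q) \<le> infdist (z + d) E powr (- q)" if "norm d = h" for d
    proof (rule powr_mono2')
      have "infdist z E \<le> infdist (z + d) E + dist z (z + d)"
        by (rule infdist_triangle)
      then show "0 < infdist (z + d) E"
        using that hr by (simp add: r_def dist_norm)
      have "infdist (z + d) E \<le> dist (z + d) \<zeta>"
        using \<zeta>(1) by (rule infdist_le)
      then show "infdist (z + d) E \<le> norm (z - \<zeta> + d)"
        by (simp add: dist_norm algebra_simps)
    qed (use q in simp)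
    have "q\<^sup>2 / 2 * r powr (- q - 2)
      \<le> (q * (q + 2) * (1 + \<epsilon>\<^sup>2) powr (- q / 2 - 2) - 2 * q) * r powr (- q - 2)"
      using \<epsilon>(3) by (intro mult_right_mono) auto
    also have "\<dots> = q * (q + 2) * (r\<^sup>2 * (1 + \<epsilon>\<^sup>2)) powr (- q / 2 - 2) * r\<^sup>2
        - 2 * q * r powr (- q - 2)"
    proof -
      have "(r\<^sup>2) powr (- q / 2 - 2) * r\<^sup>2 = r powr (- q - 2)"
        using r by (simp add: powr_powr algebra_simps powr_add[symmetric] flip: powr_numeral)
      then have "(r\<^sup>2 * (1 + \<epsilon>\<^sup>2)) powr (- q / 2 - 2) * r\<^sup>2
          = (1 + \<epsilon>\<^sup>2) powr (- q / 2 - 2) * r powr (- q - 2)"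
        using r by (simp add: powr_mult mult_ac)
      then show ?thesis
        by (simp add: left_diff_distrib mult.assoc)
    qed
    also have "\<dots> \<le> q * (q + 2) * (r\<^sup>2 + h\<^sup>2) powr (- q / 2 - 2) * r\<^sup>2 - 2 * q * r powr (- q - 2)"
    proof -
      have "h\<^sup>2 \<le> (\<epsilon> * r)\<^sup>2"
        using h by (intro power_mono) (auto simp: r_def)
      then have "(r\<^sup>2 * (1 + \<epsilon>\<^sup>2)) powr (- q / 2 - 2) \<le> (r\<^sup>2 + h\<^sup>2) powr (- q / 2 - 2)"
        using r q by (intro powr_mono2') (auto simp: algebra_simps power_mult_distrib add_nonneg_pos)
      then show ?thesis
        using q by (simp add: mult_left_mono mult_right_mono)
    qed
    finally have "h\<^sup>2 * (q\<^sup>2 / 2 * r powr (- q - 2))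
      \<le> h\<^sup>2 * (q * (q + 2) * (r\<^sup>2 + h\<^sup>2) powr (- q / 2 - 2) * r\<^sup>2 - 2 * q * r powr (- q - 2))"
      by (intro mult_left_mono) auto
    also have "\<dots> \<le> norm (z - \<zeta> + h) powr (- q) + norm (z - \<zeta> - h) powr (- q)
      + norm (z - \<zeta> + \<i> * h) powr (- q) + norm (z - \<zeta> - \<i> * h) powr (- q) - 4 * r powr (- q)"
      using norm_powr_second_difference[OF q h(1), of "z - \<zeta>"] hr unfolding r' by simp
    also have "\<dots> \<le> second_diff h (\<lambda>z. infdist z E powr (- q)) z"
      using shift[of h] shift[of "- h"] shift[of "\<i> * h"] shift[of "- \<i> * h"] h(1)
      by (simp add: second_diff_def r_def norm_mult)
    finally show "q\<^sup>2 / 2 * h\<^sup>2 * infdist z E powr (- q - 2)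
        \<le> second_diff h (\<lambda>z. infdist z E powr (- q)) z"
      by (simp add: r_def mult_ac)
  qed
qed

section \<open>The distributional Laplacian\<close>

lemma DERIV_along_line:
  assumes "\<And>z. f differentiable (at z)"
  shows "((\<lambda>t. f (z + of_real t * e)) has_real_derivative partial e f (z + of_real t * e)) (at t)"
proof -
  let ?D = "\<lambda>d. partial d f (z + of_real t * e)"
  have D: "(f has_derivative ?D) (at (z + of_real t * e))"
    using assms by (rule has_derivative_partial)
  have "((\<lambda>t. z + of_real t * e) has_derivative (\<lambda>s. of_real s * e)) (at t)"
    by (auto intro!: derivative_eq_intros)
  from has_derivative_compose[OF this D]
  have "((\<lambda>t. f (z + of_real t * e)) has_derivative (\<lambda>s. ?D (of_real s * e))) (at t)" .
  moreover have "?D (of_real s * e) = ?D e * s" for s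
    using linear_cmul[OF has_derivative_linear[OF D], of s e] by (simp add: scaleR_conv_of_real)
  ultimately show ?thesis by (simp add: has_field_derivative_def)
qed

lemma second_diff_along_line:
  assumes f: "\<And>z. f differentiable (at z)" and f': "\<And>z. partial e f differentiable (at z)" and h: "h > 0"
  obtains s where "0 < s" "s < h" and
    "f (z + of_real h * e) + f (z - of_real h * e) - 2 * f z =
      h\<^sup>2 / 2 * (partial e (partial e f) (z + of_real s * e) + partial e (partial e f) (z - of_real s * e))"
proof -
  define g where "g t = f (z + of_real t * e)" for t
  define g' where "g' t = partial e f (z + of_real t * e)" for t
  define g'' where "g'' t = partial e (partial e f) (z + of_real t * e)" for t
  have g: "(g has_real_derivative g' t) (at t)" for t
    unfolding g_def g'_def using f by (rule DERIV_along_line)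
  have g': "(g' has_real_derivative g'' t) (at t)" for t
    unfolding g'_def g''_def using f' by (rule DERIV_along_line)
  \<comment> \<open>The successive derivatives of the even function g t + g (- t). The first one
    vanishes at 0, so Maclaurin's formula of order 2 leaves 2 g 0 and the remainder, with one s for
    both directions.\<close>
  define diff :: "nat \<Rightarrow> real \<Rightarrow> real" where
    "diff = (\<lambda>m t. if m = 0 then g t + g (- t) else if m = 1 then g' t - g' (- t) else g'' t + g'' (- t))"
  have neg: "((\<lambda>t. k (- t)) has_real_derivative - k' (- t)) (at t)"
    if "\<And>t. (k has_real_derivative k' t) (at t)" for k k' t
    using that by (rule DERIV_mirror[THEN iffD1])
  have "DERIV (diff m) t :> diff (Suc m) t" if "m < 2" for m t
    using that g g' neg[OF g] neg[OF g']
    by (cases "m = 0") (auto simp: diff_def less_2_cases_iff intro!: derivative_eq_intros)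
  then obtain s where s: "0 < s" "s < h"
    "diff 0 h = (\<Sum>m<2. diff m 0 / fact m * h ^ m) + diff 2 s / fact 2 * h ^ 2"
    using Maclaurin[of h 2 diff "diff 0"] h by auto
  then have "g h + g (- h) - 2 * g 0 = h\<^sup>2 / 2 * (g'' s + g'' (- s))"
    by (simp add: diff_def numeral_2_eq_2 algebra_simps)
  with s that show thesis by (simp add: g_def g''_def)
qed

lemma second_diff_C2:
  assumes f: "C_k 2 f" and h: "h > 0"
  obtains s t where "0 < s" "s < h" "0 < t" "t < h" and
    "second_diff h f z = h\<^sup>2 / 2 *
      (partial 1 (partial 1 f) (z + of_real s) + partial 1 (partial 1 f) (z - of_real s)
       + (partial \<i> (partial \<i> f) (z + \<i> * of_real t) + partial \<i> (partial \<i> f) (z - \<i> * of_real t)))"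
proof -
  have d: "\<And>z. f differentiable (at z)" "\<And>z. partial 1 f differentiable (at z)"
    "\<And>z. partial \<i> f differentiable (at z)"
    using f by (auto simp: numeral_2_eq_2)
  obtain s where "0 < s" "s < h" 
    "f (z + of_real h * 1) + f (z - of_real h * 1) - 2 * f z =
      h\<^sup>2 / 2 * (partial 1 (partial 1 f) (z + of_real s * 1) + partial 1 (partial 1 f) (z - of_real s * 1))"
    by (rule second_diff_along_line[OF d(1,2) h])
  moreover obtain t where "0 < t" "t < h" 
    "f (z + of_real h * \<i>) + f (z - of_real h * \<i>) - 2 * f z =
      h\<^sup>2 / 2 * (partial \<i> (partial \<i> f) (z + of_real t * \<i>) + partial \<i> (partial \<i> f) (z - of_real t * \<i>))"
    by (rule second_diff_along_line[OF d(1,3) h])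
  ultimately show thesis
    by (intro that[of s t]) (auto simp: second_diff_def mult.commute[of _ \<i>] distrib_left)
qed

lemma continuous_on_second_partials:
  assumes "C_k 2 f"
  shows "continuous_on UNIV (partial 1 (partial 1 f))" "continuous_on UNIV (partial \<i> (partial \<i> f))"
  using assms by (auto simp: numeral_2_eq_2)

text \<open>The intermediate points from \<open>second_diff_C2\<close> are squeezed to z by h, and
  the second partials are continuous at z.\<close>

lemma second_diff_tendsto_laplacian:
  assumes f: "C_k 2 f" and h: "\<And>n. h n > 0" "h \<longlonglongrightarrow> 0"
  shows "(\<lambda>n. second_diff (h n) f z / (h n)\<^sup>2) \<longlonglongrightarrow> laplacian f z"
proof -
  have "\<exists>s t. \<bar>s\<bar> < h n \<and> \<bar>t\<bar> < h n \<and> second_diff (h n) f z / (h n)\<^sup>2 =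
      (partial 1 (partial 1 f) (z + of_real s) + partial 1 (partial 1 f) (z - of_real s)
       + (partial \<i> (partial \<i> f) (z + \<i> * of_real t) + partial \<i> (partial \<i> f) (z - \<i> * of_real t))) / 2" for n
    by (rule second_diff_C2[OF f h(1)[of n], of z]) (use h(1)[of n] in force)
  then obtain s t where st: "\<And>n. \<bar>s n\<bar> < h n" "\<And>n. \<bar>t n\<bar> < h n"
    and eq: "\<And>n. second_diff (h n) f z / (h n)\<^sup>2 =
      (partial 1 (partial 1 f) (z + of_real (s n)) + partial 1 (partial 1 f) (z - of_real (s n))
       + (partial \<i> (partial \<i> f) (z + \<i> * of_real (t n)) + partial \<i> (partial \<i> f) (z - \<i> * of_real (t n)))) / 2"
    by metis
  have st0: "s \<longlonglongrightarrow> 0" "t \<longlonglongrightarrow> 0"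
    by (rule Lim_null_comparison[OF _ h(2)], use st less_imp_le in \<open>auto intro!: always_eventually\<close>)+
  have c: "isCont (partial 1 (partial 1 f)) z" "isCont (partial \<i> (partial \<i> f)) z"
    using continuous_on_second_partials[OF f] by (auto simp: continuous_on_eq_continuous_at)
  have "(\<lambda>n. (partial 1 (partial 1 f) (z + of_real (s n)) + partial 1 (partial 1 f) (z - of_real (s n))
       + (partial \<i> (partial \<i> f) (z + \<i> * of_real (t n)) + partial \<i> (partial \<i> f) (z - \<i> * of_real (t n)))) / 2)
    \<longlonglongrightarrow> (partial 1 (partial 1 f) z + partial 1 (partial 1 f) z
       + (partial \<i> (partial \<i> f) z + partial \<i> (partial \<i> f) z)) / 2"
    by (intro tendsto_intros isCont_tendsto_compose[OF c(1)] isCont_tendsto_compose[OF c(2)])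
       (use st0 in \<open>auto intro!: tendsto_eq_intros\<close>)
  then show ?thesis by (simp add: eq laplacian_def add_divide_distrib)
qed

section \<open>Discrete Green identity and passage to the Laplacian\<close>

lemma integrable_times_compact_support:
  fixes f g :: "complex \<Rightarrow> real"
  assumes "continuous_on UNIV f" "continuous_on UNIV g" "\<And>z. z \<notin> cball a r \<Longrightarrow> g z = 0"
  shows "integrable lborel (\<lambda>z. f z * g z)"
proof -
  have "integrable lborel (\<lambda>z. indicator (cball a r) z *\<^sub>R (f z * g z))"
    by (rule borel_integrable_compact)
       (auto intro!: continuous_on_mult continuous_on_subset[OF assms(1)] continuous_on_subset[OF assms(2)])
  moreover have "(\<lambda>z. indicator (cball a r) z *\<^sub>R (f z * g z)) = (\<lambda>z. f z * g z)"
    using assms(3) by (force simp: indicator_def)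
  ultimately show ?thesis by simp
qed

text \<open>Translation invariance turns a shift of g by d into a shift of f by - d, and passing
  from d to - d permutes the four directions. The compact support of g makes every term
  integrable.\<close>

lemma integral_second_diff_swap:
  fixes f g :: "complex \<Rightarrow> real"
  assumes f: "continuous_on UNIV f" and g: "continuous_on UNIV g" "\<And>z. z \<notin> cball a r \<Longrightarrow> g z = 0"
  shows "integrable lborel (\<lambda>z. f z * second_diff h g z)"
    and "integrable lborel (\<lambda>z. second_diff h f z * g z)"
    and "(LINT z|lborel. f z * second_diff h g z) = (LINT z|lborel. second_diff h f z * g z)"
proof -
  have i1: "integrable lborel (\<lambda>z. f z * g (z + d))" for d
    by (rule integrable_times_compact_support[OF f, of _ "a - d" r])
       (use g in \<open>auto intro!: continuous_on_compose2[OF g(1)] continuous_intros simp: dist_norm algebra_simps\<close>)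
  have i2: "integrable lborel (\<lambda>z. f (z + d) * g z)" for d
    by (rule integrable_times_compact_support[OF _ g])
       (auto intro!: continuous_on_compose2[OF f] continuous_intros)
  have borel[measurable]: "f \<in> borel_measurable borel" "g \<in> borel_measurable borel"
    using f g by (auto intro: borel_measurable_continuous_onI)
  have shift: "(LINT z|lborel. f z * g (z + d)) = (LINT z|lborel. f (z + - d) * g z)" for d
    by (subst (2) lborel_distr_plus[of d, symmetric]) (simp add: integral_distr add.commute)
  let ?I = "\<lambda>d. LINT z|lborel. f z * g (z + d)"
  let ?J = "\<lambda>d. LINT z|lborel. f (z + d) * g z"
  have e1: "(\<lambda>z. f z * second_diff h g z) = (\<lambda>z. f z * g (z + of_real h) + f z * g (z + - of_real h)
      + f z * g (z + \<i> * of_real h) + f z * g (z + - (\<i> * of_real h)) - 4 * (f z * g (z + 0)))"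
    by (simp add: second_diff_def algebra_simps)
  have e2: "(\<lambda>z. second_diff h f z * g z) = (\<lambda>z. f (z + of_real h) * g z + f (z + - of_real h) * g z
      + f (z + \<i> * of_real h) * g z + f (z + - (\<i> * of_real h)) * g z - 4 * (f (z + 0) * g z))"
    by (simp add: second_diff_def algebra_simps)
  show "integrable lborel (\<lambda>z. f z * second_diff h g z)"
    unfolding e1 by (intro Bochner_Integration.integrable_add Bochner_Integration.integrable_diff i1 integrable_mult_right)
  show "integrable lborel (\<lambda>z. second_diff h f z * g z)"
    unfolding e2 by (intro Bochner_Integration.integrable_add Bochner_Integration.integrable_diff i2 integrable_mult_right)
  have "(LINT z|lborel. f z * second_diff h g z)
      = ?I (of_real h) + ?I (- of_real h) + ?I (\<i> * of_real h) + ?I (- (\<i> * of_real h)) - 4 * ?I 0"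
    unfolding e1 by (simp only: Bochner_Integration.integral_add Bochner_Integration.integral_diff
        Bochner_Integration.integrable_add i1 integrable_mult_right integral_mult_right_zero)
  moreover have "(LINT z|lborel. second_diff h f z * g z)
      = ?J (of_real h) + ?J (- of_real h) + ?J (\<i> * of_real h) + ?J (- (\<i> * of_real h)) - 4 * ?J 0"
    unfolding e2 by (simp only: Bochner_Integration.integral_add Bochner_Integration.integral_diff
        Bochner_Integration.integrable_add i2 integrable_mult_right integral_mult_right_zero)
  ultimately show "(LINT z|lborel. f z * second_diff h g z) = (LINT z|lborel. second_diff h f z * g z)"
    unfolding shift by simp
qed

text \<open>Supplies the dominating constant for the limit h to 0. Since h \<le> 1, the intermediate
  points stay in the disc of radius r + 1, on which the continuous second partials are
  bounded.\<close>

lemma second_diff_bound: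
  assumes f: "C_k 2 f"
  obtains M where "\<And>z h. norm z \<le> r \<Longrightarrow> 0 < h \<Longrightarrow> h \<le> 1 \<Longrightarrow> \<bar>second_diff h f z\<bar> \<le> M * h\<^sup>2"
proof -
  have "compact (partial e (partial e f) ` cball 0 (r + 1))" if "e \<in> {1, \<i>}" for e
    using that continuous_on_second_partials[OF f]
    by (auto intro!: compact_continuous_image intro: continuous_on_subset)
  then have "\<exists>B. \<forall>w\<in>cball 0 (r + 1). \<bar>partial e (partial e f) w\<bar> \<le> B" if "e \<in> {1, \<i>}" for e
    using that by (fastforce dest: compact_imp_bounded simp: bounded_iff)
  then obtain B1 B2 where B: "\<And>w. norm w \<le> r + 1 \<Longrightarrow> \<bar>partial 1 (partial 1 f) w\<bar> \<le> B1"
    "\<And>w. norm w \<le> r + 1 \<Longrightarrow> \<bar>partial \<i> (partial \<i> f) w\<bar> \<le> B2"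
    by (metis insertI1 insertI2 mem_cball_0)
  show thesis
  proof (rule that)
    fix z :: complex and h :: real assume z: "norm z \<le> r" and h: "0 < h" "h \<le> 1"
    have near: "norm (z + d) \<le> r + 1" if "norm d \<le> 1" for d
      using norm_triangle_ineq[of z d] z that by linarith
    obtain s t where st: "0 < s" "s < h" "0 < t" "t < h" and
      eq: "second_diff h f z = h\<^sup>2 / 2 *
      (partial 1 (partial 1 f) (z + of_real s) + partial 1 (partial 1 f) (z - of_real s)
       + (partial \<i> (partial \<i> f) (z + \<i> * of_real t) + partial \<i> (partial \<i> f) (z - \<i> * of_real t)))"
      (is "_ = _ * (?a + ?b + (?c + ?d))")
      by (rule second_diff_C2[OF f h(1)])
    have "\<bar>?a\<bar> \<le> B1" "\<bar>?b\<bar> \<le> B1" "\<bar>?c\<bar> \<le> B2" "\<bar>?d\<bar> \<le> B2"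
      using near[of "of_real s"] near[of "- of_real s"] near[of "\<i> * of_real t"] near[of "- (\<i> * of_real t)"]
        st h by (auto intro!: B simp: norm_mult)
    then have "\<bar>?a + ?b + (?c + ?d)\<bar> \<le> 2 * (B1 + B2)"
      unfolding abs_le_iff by auto
    then have "h\<^sup>2 / 2 * \<bar>?a + ?b + (?c + ?d)\<bar> \<le> h\<^sup>2 / 2 * (2 * (B1 + B2))"
      by (intro mult_left_mono) auto
    then show "\<bar>second_diff h f z\<bar> \<le> (B1 + B2) * h\<^sup>2"
      unfolding eq abs_mult by (simp add: algebra_simps)
  qed
qed

text \<open>The pairing with \<open>laplacian \<phi>\<close> is the limit of the pairings with the
  scaled second differences of \<phi>. Each of these moves onto the distance power by
  \<open>integral_second_diff_swap\<close>, where \<open>second_diff_infdist_powr\<close> gives a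
  lower bound independent of n.\<close>

lemma integral_infdist_powr_laplacian:
  fixes E :: "complex set" and q :: real
  assumes E: "closed E" "E \<noteq> {}" "E \<subseteq> \<T>" and q: "q > 0"
    and \<phi>: "C_k 2 \<phi>" "\<And>z. 0 \<le> \<phi> z" "\<And>z. z \<notin> cball 0 R \<Longrightarrow> \<phi> z = 0" and R: "R < 1"
  shows "integrable lborel (\<lambda>z. infdist z E powr (- q - 2) * \<phi> z)"
    and "q\<^sup>2 / 2 * (LINT z|lborel. infdist z E powr (- q - 2) * \<phi> z)
      \<le> (LINT z:\<D>|lborel. infdist z E powr (- q) * laplacian \<phi> z)"
proof -
  \<comment> \<open>Since R + \<delta> = 1 - \<delta>, shifts of length at most \<delta> keep the
    disc of radius R inside the one of radius 1 - \<delta>, where the truncation is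
    inactive.\<close>
  define \<delta> where "\<delta> = (1 - R) / 2"
  \<comment> \<open>The truncation makes the distance power continuous on the whole plane, so that translating
    integrals needs no care near the circle.\<close>
  define g where "g s z = max \<delta> (infdist z E) powr s" for s z
  have \<delta>: "\<delta> > 0" "\<delta> < 1 - R" using R by (auto simp: \<delta>_def)
  have far: "1 - norm z \<le> infdist z E" for z
  proof -
    obtain \<zeta> where "\<zeta> \<in> E" "infdist z E = dist z \<zeta>"
      using infdist_attains_inf[OF E(1,2)] by blast
    then show ?thesis
      using E(3) norm_triangle_ineq2[of \<zeta> z] by (auto simp: dist_norm norm_minus_commute)
  qed
  have g: "continuous_on UNIV (g s)" for s
    unfolding g_def using \<delta> by (intro continuous_intros) (auto simp: max_def)
  have g_eq: "g s z = infdist z E powr s" if "norm z \<le> 1 - \<delta>" for s z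
    using far[of z] that by (simp add: g_def max_def)
  have \<phi>0: "continuous_on UNIV \<phi>"
    using \<phi>(1) C_k_Suc_imp_C_k by (metis C_k.simps(1) numeral_2_eq_2)
  have eqI: "(\<lambda>z. g s z * \<phi> z) = (\<lambda>z. infdist z E powr s * \<phi> z)" for s
  proof
    fix z
    show "g s z * \<phi> z = infdist z E powr s * \<phi> z"
      using g_eq[of z s] \<phi>(3)[of z] \<delta> by (cases "norm z \<le> R") auto
  qed
  show int: "integrable lborel (\<lambda>z. infdist z E powr (- q - 2) * \<phi> z)"
    using integrable_times_compact_support[OF g[of "- q - 2"] \<phi>0 \<phi>(3)] unfolding eqI .
  obtain \<epsilon> where \<epsilon>: "\<epsilon> > 0" "\<And>z h. 0 < h \<Longrightarrow> h \<le> \<epsilon> * infdist z E \<Longrightarrow>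
      q\<^sup>2 / 2 * h\<^sup>2 * infdist z E powr (- q - 2) \<le> second_diff h (\<lambda>z. infdist z E powr (- q)) z"
    using second_diff_infdist_powr[OF E(1,2) q] by blast
  obtain M where M: "\<And>z h. norm z \<le> 1 \<Longrightarrow> 0 < h \<Longrightarrow> h \<le> 1 \<Longrightarrow> \<bar>second_diff h \<phi> z\<bar> \<le> M * h\<^sup>2"
    using second_diff_bound[OF \<phi>(1), of 1] by blast
  \<comment> \<open>Three demands on the steps: at most \<delta> for the truncation, at most 1 for
    the constant M, and at most \<epsilon> (1 - R), which by \<open>far\<close> is at most
    \<open>\<epsilon> * infdist z E\<close> on the disc of radius R.\<close>
  define h where "h n = min (min \<delta> 1) (\<epsilon> * (1 - R)) / real (Suc n)" for n
  have m: "min (min \<delta> 1) (\<epsilon> * (1 - R)) > 0" using \<delta> \<epsilon> R by simp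
  have hpos: "h n > 0" for n using m by (simp add: h_def)
  have hle: "h n \<le> min (min \<delta> 1) (\<epsilon> * (1 - R))" for n
    unfolding h_def using frac_le[OF less_imp_le[OF m] order_refl zero_less_one, of "real (Suc n)"] by simp
  have h0: "h \<longlonglongrightarrow> 0"
    unfolding h_def by (rule LIMSEQ_Suc[OF lim_const_over_n])
  have outside: "second_diff (h n) \<phi> z = 0" if "norm z > 1 - \<delta>" for n z
  proof -
    have "\<phi> (z + d) = 0" if "norm d \<le> h n" for d
      using hle[of n] that \<open>norm z > 1 - \<delta>\<close> norm_triangle_ineq2[of z "- d"]
      by (intro \<phi>(3)) (auto simp: \<delta>_def field_simps)
    from this[of "of_real (h n)"] this[of "- of_real (h n)"] this[of "\<i> * of_real (h n)"]
      this[of "- (\<i> * of_real (h n))"] this[of 0]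
    show ?thesis using hpos[of n] by (simp add: second_diff_def norm_mult)
  qed
  let ?s = "\<lambda>n z. g (- q) z * (second_diff (h n) \<phi> z / (h n)\<^sup>2)"
  have "(\<lambda>n. LINT z|lborel. ?s n z) \<longlonglongrightarrow>
      (LINT z|lborel. indicator \<D> z *\<^sub>R (infdist z E powr (- q) * laplacian \<phi> z))"
  proof (rule integral_dominated_convergence[where w = "\<lambda>z. indicator (cball 0 1) z * (\<delta> powr (- q) * M)"])
    have "continuous_on UNIV (second_diff h \<phi>)" for h
      unfolding second_diff_def by (intro continuous_intros continuous_on_compose2[OF \<phi>0]) auto
    then show borel: "?s n \<in> borel_measurable lborel" for n
      using g hpos by (auto intro!: borel_measurable_continuous_onI continuous_intros simp: less_imp_neq[symmetric])
    show "integrable lborel (\<lambda>z::complex. indicator (cball 0 1) z * (\<delta> powr (- q) * M))"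
      by (intro integrable_mult_left integrable_real_indicator emeasure_bounded_finite) auto
    show "AE z in lborel. norm (?s n z) \<le> indicator (cball 0 1) z * (\<delta> powr (- q) * M)" for n
    proof (rule AE_I2)
      fix z :: complex
      show "norm (?s n z) \<le> indicator (cball 0 1) z * (\<delta> powr (- q) * M)"
      proof (cases "norm z \<le> 1")
        case True
        have "\<bar>second_diff (h n) \<phi> z / (h n)\<^sup>2\<bar> \<le> M"
          using M[OF True hpos] hle[of n] hpos[of n] by (simp add: divide_le_eq)
        moreover have "\<bar>g (- q) z\<bar> \<le> \<delta> powr (- q)"
          using \<delta> q by (auto simp: g_def intro!: powr_mono2')
        ultimately show ?thesis
          using True mult_mono[of "\<bar>g (- q) z\<bar>" "\<delta> powr (- q)" "\<bar>second_diff (h n) \<phi> z / (h n)\<^sup>2\<bar>" M]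
          by (simp add: abs_mult)
      next
        case False
        then show ?thesis using outside[of z n] \<delta> by simp
      qed
    qed
    have lim: "(\<lambda>n. ?s n z) \<longlonglongrightarrow> indicator \<D> z *\<^sub>R (infdist z E powr (- q) * laplacian \<phi> z)" for z
    proof (cases "norm z \<le> 1 - \<delta>")
      case True
      then have "(\<lambda>n. ?s n z) \<longlonglongrightarrow> g (- q) z * laplacian \<phi> z"
        by (intro tendsto_intros second_diff_tendsto_laplacian \<phi>(1) hpos h0)
      then show ?thesis using True \<delta> g_eq[OF True] by simp
    next
      case False
      have "(\<lambda>n. second_diff (h n) \<phi> z / (h n)\<^sup>2) \<longlonglongrightarrow> laplacian \<phi> z"
        by (intro second_diff_tendsto_laplacian \<phi>(1) hpos h0)
      \<comment> \<open>The quotients are identically 0 here, so uniqueness of limits gives the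
        value without computing partial derivatives.\<close>
      then have "laplacian \<phi> z = 0"
        using outside False by (simp add: LIMSEQ_const_iff)
      then show ?thesis using outside False by simp
    qed
    then show "AE z in lborel. (\<lambda>n. ?s n z) \<longlonglongrightarrow>
        indicator \<D> z *\<^sub>R (infdist z E powr (- q) * laplacian \<phi> z)"
      by simp
    show "(\<lambda>z. indicator \<D> z *\<^sub>R (infdist z E powr (- q) * laplacian \<phi> z)) \<in> borel_measurable lborel"
      by (rule borel_measurable_LIMSEQ_metric[OF borel lim])
  qed
  moreover have "q\<^sup>2 / 2 * (LINT z|lborel. infdist z E powr (- q - 2) * \<phi> z) \<le> (LINT z|lborel. ?s n z)" for n
  proof -
    note swap = integral_second_diff_swap[OF g[of "- q"] \<phi>0, where a = 0 and r = R and h = "h n", OF \<phi>(3)]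
    have "(h n)\<^sup>2 * (q\<^sup>2 / 2 * (LINT z|lborel. infdist z E powr (- q - 2) * \<phi> z))
      = (LINT z|lborel. (q\<^sup>2 / 2 * (h n)\<^sup>2) * (infdist z E powr (- q - 2) * \<phi> z))"
      by simp
    also have "\<dots> \<le> (LINT z|lborel. second_diff (h n) (g (- q)) z * \<phi> z)"
    proof (rule integral_mono)
      fix z :: complex
      show "(q\<^sup>2 / 2 * (h n)\<^sup>2) * (infdist z E powr (- q - 2) * \<phi> z) \<le> second_diff (h n) (g (- q)) z * \<phi> z"
      proof (cases "norm z \<le> R")
        case True
        have "g (- q) (z + d) = infdist (z + d) E powr (- q)" if "norm d \<le> h n" for d
          using hle[of n] that True norm_triangle_ineq[of z d]
          by (intro g_eq) (auto simp: \<delta>_def field_simps)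
        from this[of "of_real (h n)"] this[of "- of_real (h n)"] this[of "\<i> * of_real (h n)"]
          this[of "- (\<i> * of_real (h n))"] this[of 0]
        have "second_diff (h n) (g (- q)) z = second_diff (h n) (\<lambda>z. infdist z E powr (- q)) z"
          using hpos[of n] by (simp add: second_diff_def norm_mult)
        moreover have "h n \<le> \<epsilon> * infdist z E"
        proof -
          have "h n \<le> \<epsilon> * (1 - R)" using hle[of n] by simp
          also have "\<dots> \<le> \<epsilon> * infdist z E" using far[of z] True \<epsilon>(1) by (intro mult_left_mono) auto
          finally show ?thesis .
        qed
        ultimately have "q\<^sup>2 / 2 * (h n)\<^sup>2 * infdist z E powr (- q - 2) \<le> second_diff (h n) (g (- q)) z"
          using \<epsilon>(2)[OF hpos] by simp
        then show ?thesis
          unfolding mult.assoc[symmetric] using \<phi>(2)[of z] by (rule mult_right_mono)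
      qed (simp add: \<phi>(3))
    qed (use int swap in auto)
    also have "\<dots> = (LINT z|lborel. g (- q) z * second_diff (h n) \<phi> z)"
      by (rule swap(3)[symmetric])
    also have "\<dots> = (h n)\<^sup>2 * ((LINT z|lborel. g (- q) z * second_diff (h n) \<phi> z) / (h n)\<^sup>2)"
      using hpos[of n] by simp
    also have "(LINT z|lborel. g (- q) z * second_diff (h n) \<phi> z) / (h n)\<^sup>2 = (LINT z|lborel. ?s n z)"
      by simp
    finally show ?thesis
      using hpos[of n] by (simp only: mult_le_cancel_left_pos zero_less_power)
  qed
  ultimately show "q\<^sup>2 / 2 * (LINT z|lborel. infdist z E powr (- q - 2) * \<phi> z)
      \<le> (LINT z:\<D>|lborel. infdist z E powr (- q) * laplacian \<phi> z)"
    unfolding set_lebesgue_integral_def by (intro LIMSEQ_le_const) auto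
qed

section \<open>Lower bound for the Riesz measure\<close>

text \<open>Replaces a merely continuous weight by a smooth one at the cost of a factor 2. Let m be
  the minimum of f on K. Approximating f - m / 4 within m / 4 puts g between f - m / 2 and f, and m
  \<le> f.\<close>

lemma polynomial_between_half:
  fixes f :: "'a::euclidean_space \<Rightarrow> real"
  assumes K: "compact K" "K \<noteq> {}" and f: "continuous_on K f" "\<And>x. x \<in> K \<Longrightarrow> f x > 0"
  obtains g where "real_polynomial_function g" "\<And>x. x \<in> K \<Longrightarrow> f x / 2 \<le> g x \<and> g x \<le> f x"
proof -
  obtain x0 where x0: "x0 \<in> K" "\<And>x. x \<in> K \<Longrightarrow> f x0 \<le> f x"
    using continuous_attains_inf[OF K f(1)] by blast
  define m where "m = f x0"
  have "m > 0" using f x0 by (simp add: m_def)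
  moreover have "continuous_on K (\<lambda>x. f x - m / 4)"
    using f(1) by (intro continuous_intros)
  ultimately obtain g where g: "real_polynomial_function g" "\<And>x. x \<in> K \<Longrightarrow> \<bar>f x - m / 4 - g x\<bar> < m / 4"
    using Stone_Weierstrass_real_polynomial_function[OF K(1), of "\<lambda>x. f x - m / 4" "m / 4"] by auto
  show thesis
  proof (rule that[OF g(1)])
    fix x assume "x \<in> K"
    with g(2)[of x] x0(2)[of x] show "f x / 2 \<le> g x \<and> g x \<le> f x"
      unfolding m_def abs_less_iff by auto
  qed
qed

text \<open>If the right side is infinite there is nothing to show, and otherwise both sides agree.
  Integrability of a test function with respect to the Riesz measure thus never has to be
  established.\<close>

lemma integral_le_nn_integral:
  fixes f :: "'a \<Rightarrow> real"
  assumes "f \<in> borel_measurable M" "\<And>x. 0 \<le> f x"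
  shows "ennreal (integral\<^sup>L M f) \<le> (\<integral>\<^sup>+x. ennreal (f x) \<partial>M)"
proof (cases "(\<integral>\<^sup>+x. ennreal (f x) \<partial>M) = \<infinity>")
  case False
  then show ?thesis
    using assms by (simp add: integral_eq_nn_integral less_top)
qed simp

text \<open>The weight f is controlled on the disc only; the indicator makes the product measurable
  on the whole plane.\<close>

lemma measurable_weight_on_ball:
  assumes "continuous_on \<D> f" "r \<le> 1"
  shows "(\<lambda>z. ennreal (f z * infdist z E powr s) * indicator (ball 0 r) z) \<in> borel_measurable borel"
proof -
  have "continuous_on (ball 0 r) f"
    using assms by (auto intro: continuous_on_subset)
  then have [measurable]: "(\<lambda>z. indicator (ball 0 r) z *\<^sub>R f z) \<in> borel_measurable borel"
    by (intro borel_measurable_continuous_on_indicator) auto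
  have [measurable]: "(\<lambda>z. infdist z E) \<in> borel_measurable borel"
    by (intro borel_measurable_continuous_onI continuous_intros)
  have "(\<lambda>z. ennreal ((indicator (ball 0 r) z *\<^sub>R f z) * infdist z E powr s)) \<in> borel_measurable borel"
    by measurable
  then show ?thesis
    by (rule measurable_cong[THEN iffD1, rotated]) (simp add: indicator_def)
qed

text \<open>The test function \<phi> is at most f on the disc and at least exp (- 1) / 2 times f on
  \<open>ball 0 r\<close>. The constant is the product of exp (- 1) / 2, of q^2 / 2 from the
  Laplacian bound and of 1 / (2 pi) from the Riesz measure.\<close>

lemma Riesz_measure_infdist_powr_ball:
  fixes E :: "complex set" and q r :: real
  assumes E: "closed E" "E \<noteq> {}" "E \<subseteq> \<T>" and q: "q > 0"
    and \<mu>: "is_Riesz_measure (\<lambda>z. infdist z E powr (- q)) \<mu>"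
    and f: "continuous_on \<D> f" "\<And>z. z \<in> \<D> \<Longrightarrow> f z > 0"
    and r: "0 < r" "r < 1"
  shows "ennreal (q\<^sup>2 * exp (- 1) / (8 * pi))
      * (\<integral>\<^sup>+z. ennreal (f z * infdist z E powr (- q - 2)) * indicator (ball 0 r) z \<partial>lborel)
    \<le> (\<integral>\<^sup>+z. ennreal (f z) \<partial>\<mu>)"
proof -
  define R where "R = (1 + r) / 2"
  have R: "0 < R" "r < R" "R < 1" using r by (auto simp: R_def)
  have "cball 0 R \<subseteq> \<D>" using R by auto
  then obtain p where p: "real_polynomial_function p"
    "\<And>z. z \<in> cball 0 R \<Longrightarrow> f z / 2 \<le> p z \<and> p z \<le> f z"
    using polynomial_between_half[of "cball 0 R" f] f R
    by (metis compact_cball cball_eq_empty continuous_on_subset less_le_not_le subsetD)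
  \<comment> \<open>Makes the argument of \<open>flat 0\<close> at least 1 on
    \<open>ball 0 r\<close>, so that the radial factor is at least exp (- 1) there.\<close>
  define N where "N = 1 / (R\<^sup>2 - r\<^sup>2)"
  have Rr: "r\<^sup>2 < R\<^sup>2" using R r by (simp add: power_strict_mono)
  have N: "N > 0" using Rr by (simp add: N_def)
  define \<phi> where "\<phi> z = flat 0 (N * (R\<^sup>2 - (norm z)\<^sup>2)) * p z" for z :: complex
  have test: "test_function \<D> \<phi>" and "closure {z. \<phi> z \<noteq> 0} \<subseteq> cball 0 R"
    unfolding \<phi>_def using test_function_bump[OF R(1,3) p(1) N] by auto
  then have supp: "\<phi> z = 0" if "z \<notin> cball 0 R" for z
    using that closure_subset by (metis (mono_tags, lifting) mem_Collect_eq subsetD)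
  have flat1: "flat 0 t \<le> 1" for t by (simp add: flat_def)
  have \<phi>_nonneg: "0 \<le> \<phi> z" for z
  proof (cases "z \<in> cball 0 R")
    case True
    then have "0 \<le> p z" using p(2)[OF True] f(2)[of z] \<open>cball 0 R \<subseteq> \<D>\<close> by force
    then show ?thesis by (simp add: \<phi>_def flat_nonneg)
  qed (simp add: supp)
  have \<phi>_le: "\<phi> z \<le> f z" if "z \<in> \<D>" for z
  proof (cases "z \<in> cball 0 R")
    case True
    have "\<phi> z \<le> 1 * p z"
      unfolding \<phi>_def using p(2)[OF True] f(2)[OF that] by (intro mult_right_mono flat1) auto
    then show ?thesis using p(2)[OF True] by simp
  qed (use supp f(2)[OF that] in auto)
  have \<phi>_ge: "exp (- 1) / 2 * f z \<le> \<phi> z" if "z \<in> ball 0 r" for z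
  proof -
    have "(norm z)\<^sup>2 \<le> r\<^sup>2" using that r by (intro power_mono) auto
    then have "1 \<le> N * (R\<^sup>2 - (norm z)\<^sup>2)" using Rr by (simp add: N_def)
    then have "exp (- 1) \<le> flat 0 (N * (R\<^sup>2 - (norm z)\<^sup>2))"
      unfolding flat_def by (simp add: divide_le_eq_1)
    moreover have "f z / 2 \<le> p z" using p(2)[of z] that R by simp
    moreover have "0 < f z" using f(2)[of z] that r by simp
    ultimately have "exp (- 1) * (f z / 2) \<le> \<phi> z"
      unfolding \<phi>_def by (intro mult_mono flat_nonneg) auto
    then show ?thesis by simp
  qed
  have "C_k k \<phi>" for k
    using test by (simp add: test_function_def)
  from this[of 2] this[of 0] have C2: "C_k 2 \<phi>" and "continuous_on UNIV \<phi>"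
    by simp_all
  then have [measurable]: "\<phi> \<in> borel_measurable borel"
    by (intro borel_measurable_continuous_onI)
  have sets: "sets \<mu> = sets (restrict_space borel \<D>)"
    and Riesz: "(\<integral>z. \<phi> z \<partial>\<mu>) = 1 / (2 * pi) * (LINT z:\<D>|lborel. infdist z E powr (- q) * laplacian \<phi> z)"
    using \<mu> test by (auto simp: is_Riesz_measure_def)
  have space: "space \<mu> = \<D>"
    using sets_eq_imp_space_eq[OF sets] by (simp add: space_restrict_space)
  have \<phi>_meas: "\<phi> \<in> borel_measurable \<mu>"
    unfolding measurable_cong_sets[OF sets refl] by (rule measurable_restrict_space1) simp
  note lap = integral_infdist_powr_laplacian[OF E q C2 \<phi>_nonneg supp R(3)]
  let ?c = "q\<^sup>2 * exp (- 1) / (8 * pi)" and ?w = "\<lambda>z. infdist z E powr (- q - 2)"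
  have "ennreal ?c * (\<integral>\<^sup>+z. ennreal (f z * ?w z) * indicator (ball 0 r) z \<partial>lborel)
    \<le> ennreal (q\<^sup>2 / (4 * pi)) * (ennreal (exp (- 1) / 2) * (\<integral>\<^sup>+z. ennreal (f z * ?w z) * indicator (ball 0 r) z \<partial>lborel))"
    using q by (simp add: mult.assoc[symmetric] ennreal_mult[symmetric])
  also have "\<dots> \<le> ennreal (q\<^sup>2 / (4 * pi)) * (\<integral>\<^sup>+z. ennreal (exp (- 1) / 2) * (ennreal (f z * ?w z) * indicator (ball 0 r) z) \<partial>lborel)"
    using measurable_weight_on_ball[OF f(1), of r] r by (simp add: nn_integral_cmult)
  also have "\<dots> \<le> ennreal (q\<^sup>2 / (4 * pi)) * (\<integral>\<^sup>+z. ennreal (?w z * \<phi> z) \<partial>lborel)"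
  proof (intro mult_left_mono nn_integral_mono)
    fix z :: complex
    show "ennreal (exp (- 1) / 2) * (ennreal (f z * ?w z) * indicator (ball 0 r) z) \<le> ennreal (?w z * \<phi> z)"
    proof (cases "z \<in> ball 0 r")
      case True
      then have "exp (- 1) / 2 * (f z * ?w z) \<le> ?w z * \<phi> z"
        using mult_left_mono[OF \<phi>_ge[OF True], of "?w z"] by (simp add: mult_ac)
      then show ?thesis
        using True by (simp add: ennreal_mult'[symmetric] ennreal_leI)
    qed simp
  qed simp
  also have "\<dots> = ennreal (q\<^sup>2 / (4 * pi)) * ennreal (LINT z|lborel. ?w z * \<phi> z)"
    using lap(1) \<phi>_nonneg by (simp add: nn_integral_eq_integral)
  also have "\<dots> = ennreal (1 / (2 * pi) * (q\<^sup>2 / 2 * (LINT z|lborel. ?w z * \<phi> z)))"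
    by (simp add: ennreal_mult'[symmetric])
  also have "\<dots> \<le> ennreal (\<integral>z. \<phi> z \<partial>\<mu>)"
    unfolding Riesz using lap(2) by (intro ennreal_leI mult_left_mono) auto
  also have "\<dots> \<le> (\<integral>\<^sup>+z. ennreal (\<phi> z) \<partial>\<mu>)"
    by (rule integral_le_nn_integral[OF \<phi>_meas \<phi>_nonneg])
  also have "\<dots> \<le> (\<integral>\<^sup>+z. ennreal (f z) \<partial>\<mu>)"
    using \<phi>_le by (intro nn_integral_mono ennreal_leI) (simp add: space)
  finally show ?thesis .
qed

text \<open>The constant for \<open>ball 0 r\<close> does not depend on r, so monotone convergence
  along radii increasing to 1 applies.\<close>

lemma Riesz_measure_infdist_powr:
  fixes E :: "complex set" and q :: real
  assumes E: "closed E" "E \<noteq> {}" "E \<subseteq> \<T>" and q: "q > 0"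
    and \<mu>: "is_Riesz_measure (\<lambda>z. infdist z E powr (- q)) \<mu>"
    and f: "continuous_on \<D> f" "\<And>z. z \<in> \<D> \<Longrightarrow> f z > 0"
  shows "ennreal (q\<^sup>2 * exp (- 1) / (8 * pi))
      * (\<integral>\<^sup>+z. ennreal (f z * infdist z E powr (- q - 2)) * indicator \<D> z \<partial>lborel)
    \<le> (\<integral>\<^sup>+z. ennreal (f z) \<partial>\<mu>)"
proof -
  define G where "G n z = ennreal (f z * infdist z E powr (- q - 2)) * indicator (ball 0 (1 - inverse (real (Suc (Suc n))))) z"
    for n and z :: complex
  have rn: "0 < 1 - inverse (real (Suc (Suc n)))" "1 - inverse (real (Suc (Suc n))) < 1" for n
    by (auto simp: inverse_less_1_iff)
  have SUP: "ennreal (f z * infdist z E powr (- q - 2)) * indicator \<D> z = (SUP n. G n z)" for z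
  proof (rule antisym)
    show "(SUP n. G n z) \<le> ennreal (f z * infdist z E powr (- q - 2)) * indicator \<D> z"
      unfolding G_def using rn by (intro SUP_least mult_left_mono) (auto simp: indicator_def intro: less_trans)
    show "ennreal (f z * infdist z E powr (- q - 2)) * indicator \<D> z \<le> (SUP n. G n z)"
    proof (cases "z \<in> \<D>")
      case True
      then obtain n where n: "inverse (real (Suc n)) < 1 - norm z"
        using reals_Archimedean[of "1 - norm z"] by auto
      have "inverse (real (Suc (Suc n))) \<le> inverse (real (Suc n))"
        by (intro le_imp_inverse_le) auto
      with n have "z \<in> ball 0 (1 - inverse (real (Suc (Suc n))))"
        unfolding mem_ball_0 by linarith
      with True show ?thesis
        by (intro SUP_upper2[of n]) (simp_all add: G_def)
    qed simp
  qed
  have "incseq G"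
  proof (intro incseq_SucI le_funI)
    fix n and z :: complex
    have "inverse (real (Suc (Suc (Suc n)))) \<le> inverse (real (Suc (Suc n)))"
      by (intro le_imp_inverse_le) auto
    then have "z \<in> ball 0 (1 - inverse (real (Suc (Suc (Suc n)))))"
      if "z \<in> ball 0 (1 - inverse (real (Suc (Suc n))))"
      using that unfolding mem_ball_0 by linarith
    then show "G n z \<le> G (Suc n) z"
      unfolding G_def
      by (cases "z \<in> ball 0 (1 - inverse (real (Suc (Suc n))))") (simp_all only: indicator_simps mult_zero_right zero_le order_refl simp_thms)
  qed
  have meas: "G n \<in> borel_measurable lborel" for n
    unfolding G_def using measurable_weight_on_ball[OF f(1)] rn[of n] by simp
  show ?thesis
    unfolding SUP nn_integral_monotone_convergence_SUP[OF \<open>incseq G\<close> meas] SUP_mult_left_ennreal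
    unfolding G_def using rn by (intro SUP_least Riesz_measure_infdist_powr_ball[OF assms])
qed

section \<open>Integration over the disc by rotation averaging\<close>

lemma measurable_Complex[measurable (raw)]:
  assumes "f \<in> borel_measurable M" "g \<in> borel_measurable M"
  shows "(\<lambda>x. Complex (f x) (g x)) \<in> borel_measurable M"
  using assms by (simp add: Complex_eq)

lemma lborel_complex_eq: "(lborel :: complex measure) = distr (lborel \<Otimes>\<^sub>M lborel) borel (\<lambda>(x, y). Complex x y)"
proof (rule lborel_eqI)
  have [measurable]: "(\<lambda>(x, y). Complex x y) \<in> borel_measurable (lborel \<Otimes>\<^sub>M lborel)"
    unfolding case_prod_beta' by measurable
  fix l u :: complex assume le: "\<And>b. b \<in> Basis \<Longrightarrow> l \<bullet> b \<le> u \<bullet> b"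
  have le': "Re l \<le> Re u" "Im l \<le> Im u"
    using le[of 1] le[of \<i>] by (auto simp: Basis_complex_def)
  have "(\<lambda>(x, y). Complex x y) -` box l u \<inter> space (lborel \<Otimes>\<^sub>M lborel) = {Re l<..<Re u} \<times> {Im l<..<Im u}"
    by (auto simp: box_def Basis_complex_def space_pair_measure)
  then show "emeasure (distr (lborel \<Otimes>\<^sub>M lborel) borel (\<lambda>(x, y). Complex x y)) (box l u)
      = ennreal (\<Prod>b\<in>Basis. (u - l) \<bullet> b)"
    using le' by (simp add: emeasure_distr lborel.emeasure_pair_measure_Times Basis_complex_def ennreal_mult)
qed simp

lemma nn_integral_complex:
  assumes [measurable]: "F \<in> borel_measurable borel"
  shows "(\<integral>\<^sup>+z. F z \<partial>lborel) = (\<integral>\<^sup>+y. \<integral>\<^sup>+x. F (Complex x y) \<partial>lborel \<partial>lborel)"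
    and "(\<integral>\<^sup>+z. F z \<partial>lborel) = (\<integral>\<^sup>+x. \<integral>\<^sup>+y. F (Complex x y) \<partial>lborel \<partial>lborel)"
proof -
  have "(\<integral>\<^sup>+z. F z \<partial>lborel) = (\<integral>\<^sup>+p. F (Complex (fst p) (snd p)) \<partial>(lborel \<Otimes>\<^sub>M lborel))"
    by (subst lborel_complex_eq, subst nn_integral_distr) (auto simp: case_prod_beta')
  moreover have "(\<integral>\<^sup>+y. \<integral>\<^sup>+x. F (Complex x y) \<partial>lborel \<partial>lborel)
      = (\<integral>\<^sup>+p. F (Complex (fst p) (snd p)) \<partial>(lborel \<Otimes>\<^sub>M lborel))"
    by (subst lborel_pair.nn_integral_snd[symmetric]) auto
  moreover have "(\<integral>\<^sup>+x. \<integral>\<^sup>+y. F (Complex x y) \<partial>lborel \<partial>lborel)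
      = (\<integral>\<^sup>+p. F (Complex (fst p) (snd p)) \<partial>(lborel \<Otimes>\<^sub>M lborel))"
    by (subst lborel.nn_integral_fst[symmetric]) auto
  ultimately show "(\<integral>\<^sup>+z. F z \<partial>lborel) = (\<integral>\<^sup>+y. \<integral>\<^sup>+x. F (Complex x y) \<partial>lborel \<partial>lborel)"
    "(\<integral>\<^sup>+z. F z \<partial>lborel) = (\<integral>\<^sup>+x. \<integral>\<^sup>+y. F (Complex x y) \<partial>lborel \<partial>lborel)"
    by simp_all
qed

lemma nn_integral_translate:
  fixes f :: "real \<Rightarrow> ennreal"
  assumes "f \<in> borel_measurable borel"
  shows "(\<integral>\<^sup>+x. f (x + c) \<partial>lborel) = (\<integral>\<^sup>+x. f x \<partial>lborel)"
  using nn_integral_real_affine[OF assms, of 1 c] by (simp add: add.commute)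

lemma nn_integral_shear:
  assumes [measurable]: "F \<in> borel_measurable borel"
  shows "(\<integral>\<^sup>+z. F (Complex (Re z + k * Im z) (Im z)) \<partial>lborel) = (\<integral>\<^sup>+z. F z \<partial>lborel)"
    and "(\<integral>\<^sup>+z. F (Complex (Re z) (Im z + k * Re z)) \<partial>lborel) = (\<integral>\<^sup>+z. F z \<partial>lborel)"
proof -
  have "(\<integral>\<^sup>+z. F (Complex (Re z + k * Im z) (Im z)) \<partial>lborel)
      = (\<integral>\<^sup>+y. \<integral>\<^sup>+x. F (Complex (x + k * y) y) \<partial>lborel \<partial>lborel)"
    by (subst nn_integral_complex(1)) auto
  also have "\<dots> = (\<integral>\<^sup>+z. F z \<partial>lborel)"
    by (subst nn_integral_complex(1)) (auto intro!: nn_integral_cong nn_integral_translate)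
  finally show "(\<integral>\<^sup>+z. F (Complex (Re z + k * Im z) (Im z)) \<partial>lborel) = (\<integral>\<^sup>+z. F z \<partial>lborel)" .
  have "(\<integral>\<^sup>+z. F (Complex (Re z) (Im z + k * Re z)) \<partial>lborel)
      = (\<integral>\<^sup>+x. \<integral>\<^sup>+y. F (Complex x (y + k * x)) \<partial>lborel \<partial>lborel)"
    by (subst nn_integral_complex(2)) auto
  also have "\<dots> = (\<integral>\<^sup>+z. F z \<partial>lborel)"
    by (subst nn_integral_complex(2)) (auto intro!: nn_integral_cong nn_integral_translate)
  finally show "(\<integral>\<^sup>+z. F (Complex (Re z) (Im z + k * Re z)) \<partial>lborel) = (\<integral>\<^sup>+z. F z \<partial>lborel)" .
qed

text \<open>A rotation other than \<open>- 1\<close> is a product of three shears, and shears preserve area by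
  Fubini and translation invariance.\<close>

lemma nn_integral_rotate:
  assumes [measurable]: "F \<in> borel_measurable borel" and u: "norm (u :: complex) = 1"
  shows "(\<integral>\<^sup>+z. F (u * z) \<partial>lborel) = (\<integral>\<^sup>+z. F z \<partial>lborel)"
proof -
  have *: "(\<integral>\<^sup>+z. F (u * z) \<partial>lborel) = (\<integral>\<^sup>+z. F z \<partial>lborel)"
    if [measurable]: "F \<in> borel_measurable borel" and u: "norm u = 1" "u \<noteq> - 1" for u :: complex and F
  proof -
    \<comment> \<open>For u = \<open>cis \<theta>\<close> the number t is the tangent of \<theta> /
      2, which is why u = - 1 is excluded. The rotation is a vertical shear by s between two
      horizontal shears by - t.\<close>
    define c s t where "c = Re u" and "s = Im u" and "t = s / (1 + c)"
    have cs: "c\<^sup>2 + s\<^sup>2 = 1" using u(1) by (simp add: c_def s_def cmod_def)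
    have "c \<noteq> - 1"
    proof
      assume "c = - 1"
      then have "u = - 1" using cs by (simp add: c_def s_def complex_eq_iff)
      with u(2) show False ..
    qed
    then have c: "1 + c \<noteq> 0" by linarith
    have ts: "t * (1 + c) = s" using c by (simp add: t_def)
    have "t * s * (1 + c) = (1 - c) * (1 + c)"
      using ts cs by (simp add: algebra_simps power2_eq_square)
    then have ts': "t * s = 1 - c" using c by (simp only: mult_cancel_right) simp
    have tst: "t * s * t = (1 - c) * t" unfolding ts' ..
    let ?A = "\<lambda>z. Complex (Re z + (- t) * Im z) (Im z)" and ?B = "\<lambda>z. Complex (Re z) (Im z + s * Re z)"
    have eq: "u * z = ?A (?B (?A z))" for z
    proof -
      have "Re z * (c + t * s) = Re z" "Im z * (t + c * t) = Im z * s" "Im z * (t * s + c) = Im z"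
        using ts ts' by (simp_all add: algebra_simps)
      moreover have "Im z * (t * s * t) = Im z * (1 - c) * t" unfolding tst by simp
      ultimately show ?thesis
        by (simp add: complex_eq_iff c_def[symmetric] s_def[symmetric] algebra_simps)
    qed
    have "(\<integral>\<^sup>+z. F (u * z) \<partial>lborel) = (\<integral>\<^sup>+z. F (?A (?B (?A z))) \<partial>lborel)"
      by (simp only: eq)
    also have "\<dots> = (\<integral>\<^sup>+z. F (?A (?B z)) \<partial>lborel)"
      by (rule nn_integral_shear(1)[of "\<lambda>z. F (?A (?B z))"]) measurable
    also have "\<dots> = (\<integral>\<^sup>+z. F (?A z) \<partial>lborel)"
      by (rule nn_integral_shear(2)[of "\<lambda>z. F (?A z)"]) measurable
    also have "\<dots> = (\<integral>\<^sup>+z. F z \<partial>lborel)"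
      by (rule nn_integral_shear(1)) measurable
    finally show ?thesis .
  qed
  show ?thesis
  proof (cases "u = - 1")
    \<comment> \<open>The half turn is two quarter turns, to which the shear decomposition
      applies.\<close>
    case True
    have "(\<integral>\<^sup>+z. F (u * z) \<partial>lborel) = (\<integral>\<^sup>+z. F (\<i> * (\<i> * z)) \<partial>lborel)"
      using True by (simp flip: mult.assoc)
    also have "\<dots> = (\<integral>\<^sup>+z. F (\<i> * z) \<partial>lborel)"
      by (rule *[of "\<lambda>z. F (\<i> * z)"]) (auto simp: complex_eq_iff)
    also have "\<dots> = (\<integral>\<^sup>+z. F z \<partial>lborel)"
      by (rule *) (auto simp: complex_eq_iff)
    finally show ?thesis .
  qed (use * u assms(1) in auto)
qed

section \<open>Averages over circles and radial integrals\<close>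

lemma nn_integral_shift_period:
  fixes f :: "real \<Rightarrow> ennreal"
  assumes [measurable]: "f \<in> borel_measurable borel"
    and per: "\<And>x. f (x + p) = f x" and t: "0 \<le> t" "t \<le> p"
  shows "(\<integral>\<^sup>+x\<in>{0..<p}. f (x + t) \<partial>lborel) = (\<integral>\<^sup>+x\<in>{0..<p}. f x \<partial>lborel)"
proof -
  have "(\<integral>\<^sup>+x\<in>{0..<p}. f (x + t) \<partial>lborel) = (\<integral>\<^sup>+x. f (x + t) * indicator {t..<p + t} (x + t) \<partial>lborel)"
    by (auto intro!: nn_integral_cong simp: indicator_def)
  also have "\<dots> = (\<integral>\<^sup>+x. f x * indicator {t..<p + t} x \<partial>lborel)"
    by (rule nn_integral_translate) simp
  also have "\<dots> = (\<integral>\<^sup>+x. f x * indicator {t..<p} x + f x * indicator {p..<p + t} x \<partial>lborel)"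
    using t by (auto intro!: nn_integral_cong simp: indicator_def)
  also have "\<dots> = (\<integral>\<^sup>+x. f x * indicator {t..<p} x \<partial>lborel) + (\<integral>\<^sup>+x. f x * indicator {p..<p + t} x \<partial>lborel)"
    by (rule nn_integral_add) auto
  also have "(\<integral>\<^sup>+x. f x * indicator {p..<p + t} x \<partial>lborel)
      = (\<integral>\<^sup>+x. f (x + p) * indicator {p..<p + t} (x + p) \<partial>lborel)"
    by (rule nn_integral_translate[symmetric]) simp
  also have "\<dots> = (\<integral>\<^sup>+x. f x * indicator {0..<t} x \<partial>lborel)"
    by (auto intro!: nn_integral_cong simp: indicator_def per)
  also have "(\<integral>\<^sup>+x. f x * indicator {t..<p} x \<partial>lborel) + \<dots>
      = (\<integral>\<^sup>+x. f x * indicator {t..<p} x + f x * indicator {0..<t} x \<partial>lborel)"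
    by (rule nn_integral_add[symmetric]) auto
  also have "\<dots> = (\<integral>\<^sup>+x\<in>{0..<p}. f x \<partial>lborel)"
    using t by (auto intro!: nn_integral_cong simp: indicator_def)
  finally show ?thesis .
qed

text \<open>The angular half of polar coordinates. Integrating rotation invariance over all angles
  and exchanging the integrals leaves, for each z, an integral over the circle through z;
  periodicity removes its starting angle \<open>Arg2pi z\<close>.\<close>

lemma nn_integral_circle_average:
  fixes F :: "complex \<Rightarrow> ennreal"
  assumes [measurable]: "F \<in> borel_measurable borel"
  shows "ennreal (2 * pi) * (\<integral>\<^sup>+z. F z \<partial>lborel)
    = (\<integral>\<^sup>+z. (\<integral>\<^sup>+\<theta>\<in>{0..<2 * pi}. F (of_real (norm z) * cis \<theta>) \<partial>lborel) \<partial>(lborel :: complex measure))"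
proof -
  have [measurable]: "cis \<in> borel_measurable borel"
    by (intro borel_measurable_continuous_onI continuous_intros)
  have "ennreal (2 * pi) * (\<integral>\<^sup>+z. F z \<partial>lborel)
      = (\<integral>\<^sup>+\<theta>. (\<integral>\<^sup>+z. F z \<partial>lborel) * indicator {0..<2 * pi} \<theta> \<partial>lborel)"
    by (simp add: nn_integral_cmult mult.commute)
  also have "\<dots> = (\<integral>\<^sup>+\<theta>. (\<integral>\<^sup>+z. F (cis \<theta> * z) * indicator {0..<2 * pi} \<theta> \<partial>lborel) \<partial>lborel)"
    by (simp add: nn_integral_multc nn_integral_rotate)
  also have "\<dots> = (\<integral>\<^sup>+z. (\<integral>\<^sup>+\<theta>. F (cis \<theta> * z) * indicator {0..<2 * pi} \<theta> \<partial>lborel) \<partial>lborel)"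
    by (rule lborel_pair.Fubini') measurable
  also have "\<dots> = (\<integral>\<^sup>+z. (\<integral>\<^sup>+\<theta>\<in>{0..<2 * pi}. F (of_real (norm z) * cis \<theta>) \<partial>lborel) \<partial>(lborel :: complex measure))"
  proof (rule nn_integral_cong)
    fix z :: complex
    have z: "0 \<le> Arg2pi z" "Arg2pi z \<le> 2 * pi" "z = of_real (norm z) * cis (Arg2pi z)"
      using Arg2pi[of z] by (auto simp: cis_conv_exp mult.commute is_Arg_def)
    have rot: "cis \<theta> * z = of_real (norm z) * cis (\<theta> + Arg2pi z)" for \<theta>
      by (subst z(3)) (simp add: cis_mult[symmetric] mult_ac)
    show "(\<integral>\<^sup>+\<theta>\<in>{0..<2 * pi}. F (cis \<theta> * z) \<partial>lborel)
        = (\<integral>\<^sup>+\<theta>\<in>{0..<2 * pi}. F (of_real (norm z) * cis \<theta>) \<partial>lborel)"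
      unfolding rot using z(1,2)
      by (intro nn_integral_shift_period[where f = "\<lambda>\<theta>. F (of_real (norm z) * cis \<theta>)"])
         (auto simp: cis_mult[symmetric])
  qed
  finally show ?thesis .
qed

text \<open>The radial half of polar coordinates. It suffices to compare the finite values on the
  half-lines \<open>{x<..}\<close>, and both measures give the area of the part of the disc outside
  \<open>cball 0 x\<close>.\<close>

lemma distr_norm_unit_disc:
  "distr (density lborel (indicator \<D>)) borel norm
    = density lborel (\<lambda>r. ennreal (2 * pi * r) * indicator {0..<1} r)" (is "?M = ?N")
proof (rule measure_eqI_lessThan)
  have M: "emeasure ?M {x<..} = emeasure lborel (\<D> - cball 0 x)" for x
  proof -
    have "emeasure ?M {x<..} = emeasure (density lborel (indicator \<D>)) {z :: complex. x < norm z}"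
      by (subst emeasure_distr) (auto intro!: arg_cong2[where f = emeasure])
    also have "\<dots> = (\<integral>\<^sup>+z. indicator \<D> z * indicator {z :: complex. x < norm z} z \<partial>lborel)"
      by (rule emeasure_density) (auto intro!: borel_measurable_indicator)
    also have "\<dots> = (\<integral>\<^sup>+z. indicator (\<D> - cball 0 x) z \<partial>lborel)"
      by (auto intro!: nn_integral_cong simp: indicator_def)
    finally show ?thesis by simp
  qed
  show "emeasure ?M {x<..} < \<infinity>" for x
    unfolding M by (rule emeasure_bounded_finite) (auto intro: bounded_subset[OF bounded_ball])
  fix x :: real
  \<comment> \<open>Clamping x to the unit interval gives the single formula pi (1 - y^2) for the
    area, also when x < 0 or x > 1.\<close>
  define y where "y = max 0 (min 1 x)"
  have y: "0 \<le> y" "y \<le> 1" by (auto simp: y_def)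
  have "emeasure ?N {x<..} = (\<integral>\<^sup>+r. ennreal (2 * pi * r) * indicator {y..1} r \<partial>lborel)"
    by (simp add: emeasure_density)
       (intro nn_integral_cong_AE, use AE_lborel_singleton[of y] AE_lborel_singleton[of 1] in eventually_elim,
        auto simp: y_def indicator_def)
  also have "\<dots> = ennreal (pi * 1\<^sup>2 - pi * y\<^sup>2)"
    using y by (intro nn_integral_FTC_Icc[where F = "\<lambda>r. pi * r\<^sup>2"]) (auto intro!: derivative_eq_intros)
  also have "\<dots> = emeasure lborel \<D> - emeasure lborel (cball 0 y :: complex set)"
    using y by (simp add: emeasure_ball emeasure_cball unit_ball_vol_2 ennreal_minus)
  also have "\<dots> = emeasure lborel (\<D> - cball 0 x)"
  proof (cases "x < 1")
    case True
    have "emeasure lborel (\<D> - cball 0 x) = emeasure lborel \<D> - emeasure lborel (cball 0 x :: complex set)"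
      using True emeasure_bounded_finite[of "cball 0 x :: complex set"]
      by (intro emeasure_Diff) (auto simp: less_top)
    moreover have "emeasure lborel (cball 0 y :: complex set) = emeasure lborel (cball 0 x :: complex set)"
      using True by (cases "x < 0") (auto simp: y_def emeasure_cball)
    ultimately show ?thesis by simp
  next
    case False
    then have empty: "\<D> - cball 0 x = {}" and "y = 1" by (auto simp: y_def)
    then show ?thesis unfolding empty by (simp add: emeasure_ball emeasure_cball)
  qed
  finally show "emeasure ?M {x<..} = emeasure ?N {x<..}"
    unfolding M ..
qed auto

lemma nn_integral_radial:
  assumes [measurable]: "k \<in> borel_measurable borel"
  shows "(\<integral>\<^sup>+z\<in>\<D>. k (norm z) \<partial>lborel) = (\<integral>\<^sup>+r\<in>{0..<1}. ennreal (2 * pi * r) * k r \<partial>lborel)"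
proof -
  have "(\<integral>\<^sup>+z\<in>\<D>. k (norm z) \<partial>lborel) = (\<integral>\<^sup>+r. k r \<partial>distr (density lborel (indicator \<D>)) borel norm)"
    by (subst nn_integral_distr, simp, simp, subst nn_integral_density) (auto intro!: borel_measurable_indicator simp: mult.commute)
  then show ?thesis
    unfolding distr_norm_unit_disc by (simp add: nn_integral_density mult_ac)
qed

section \<open>Divergence of the area integral\<close>

lemma nu_eq_nn_integral:
  "ennreal (2 * pi * nu E s) = (\<integral>\<^sup>+\<theta>\<in>{0..<2 * pi}. indicator {..<s} (infdist (cis \<theta>) E) \<partial>lborel)"
proof -
  have [measurable]: "(\<lambda>\<theta>. infdist (cis \<theta>) E) \<in> borel_measurable borel"
    by (intro borel_measurable_continuous_onI continuous_intros)
  let ?A = "{\<theta>\<in>{0..<2 * pi}. cis \<theta> \<in> circle_nbhd E s}"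
  have A: "?A = {0..<2 * pi} \<inter> {\<theta>. infdist (cis \<theta>) E < s}"
    by (auto simp: circle_nbhd_def)
  have meas: "?A \<in> sets borel" unfolding A by measurable
  have "2 * pi * nu E s = measure lborel ?A"
    using meas by (simp add: nu_def circle_measure_def)
  also have "ennreal (measure lborel ?A) = emeasure lborel ?A"
  proof (rule emeasure_eq_ennreal_measure[symmetric])
    have "bounded ?A" by (rule bounded_subset[of "{0..2 * pi}"]) auto
    then show "emeasure lborel ?A \<noteq> top" using emeasure_bounded_finite[of ?A] by auto
  qed
  also have "\<dots> = (\<integral>\<^sup>+\<theta>. indicator ?A \<theta> \<partial>lborel)"
    using meas by simp
  also have "\<dots> = (\<integral>\<^sup>+\<theta>\<in>{0..<2 * pi}. indicator {..<s} (infdist (cis \<theta>) E) \<partial>lborel)"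
    unfolding A by (auto intro!: nn_integral_cong simp: indicator_def)
  finally show ?thesis .
qed

lemma nu_nonneg: "0 \<le> nu E s"
  by (simp add: nu_def circle_measure_def)

lemma nu_le_1: "nu E s \<le> 1"
proof -
  have "ennreal (2 * pi * nu E s) \<le> (\<integral>\<^sup>+\<theta>. indicator {0..<2 * pi} \<theta> \<partial>lborel)"
    unfolding nu_eq_nn_integral by (intro nn_integral_mono) (auto simp: indicator_def)
  then have "ennreal (2 * pi * nu E s) \<le> ennreal (2 * pi)" by simp
  then show ?thesis by (simp add: ennreal_le_iff)
qed

lemma borel_measurable_nu [measurable]: "nu E \<in> borel_measurable borel"
proof (rule borel_measurable_mono, rule monoI)
  fix s t :: real assume "s \<le> t"
  then have "ennreal (2 * pi * nu E s) \<le> ennreal (2 * pi * nu E t)"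
    unfolding nu_eq_nn_integral by (intro nn_integral_mono) (auto simp: indicator_def)
  then show "nu E s \<le> nu E t"
    using nu_nonneg[of E] by (simp add: ennreal_le_iff)
qed

text \<open>The part over s > 1/2 is finite because \<open>nu\<close> is at most 1. Cutting at 1/2
  keeps the radius 1 - s at least 1/2 in \<open>area_integral_infinite\<close>, which bounds the
  polar factor from below.\<close>

lemma I_int_near_0:
  assumes "\<alpha> \<ge> 0" "I_int \<alpha> E = \<infinity>"
  shows "(\<integral>\<^sup>+s\<in>{0<..1/2}. ennreal (nu E s / s powr (\<alpha> + 1)) \<partial>lborel) = \<infinity>"
proof -
  let ?f = "\<lambda>s. ennreal (nu E s / s powr (\<alpha> + 1))"
  have "I_int \<alpha> E = (\<integral>\<^sup>+s. ?f s * indicator {0<..1/2} s + ?f s * indicator {1/2<..2} s \<partial>lborel)"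
    unfolding I_int_def by (intro nn_integral_cong) (auto simp: indicator_def)
  also have "\<dots> = (\<integral>\<^sup>+s\<in>{0<..1/2}. ?f s \<partial>lborel) + (\<integral>\<^sup>+s\<in>{1/2<..2}. ?f s \<partial>lborel)"
    by (rule nn_integral_add) measurable
  finally have "(\<integral>\<^sup>+s\<in>{0<..1/2}. ?f s \<partial>lborel) + (\<integral>\<^sup>+s\<in>{1/2<..2}. ?f s \<partial>lborel) = \<infinity>"
    using assms(2) by simp
  moreover have "(\<integral>\<^sup>+s\<in>{1/2<..2}. ?f s \<partial>lborel) < \<infinity>"
  proof -
    have "nu E s / s powr (\<alpha> + 1) \<le> 1 / (1/2) powr (\<alpha> + 1)" if "1/2 < s" for s
      using that assms(1) nu_le_1[of E s] nu_nonneg[of E s] by (intro frac_le powr_mono2) auto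
    then have "(\<integral>\<^sup>+s\<in>{1/2<..2}. ?f s \<partial>lborel)
        \<le> (\<integral>\<^sup>+s. ennreal (1 / (1/2) powr (\<alpha> + 1)) * indicator {1/2<..2} s \<partial>(lborel :: real measure))"
      by (intro nn_integral_mono) (auto simp: indicator_def intro!: ennreal_leI)
    also have "\<dots> = ennreal (1 / (1/2) powr (\<alpha> + 1)) * emeasure lborel {1/2<..2::real}"
      by (rule nn_integral_cmult_indicator) simp
    also have "\<dots> < \<infinity>"
      by (simp add: ennreal_mult_less_top)
    finally show ?thesis .
  qed
  ultimately show ?thesis by (auto simp: ennreal_add_eq_top)
qed

lemma area_integral_infinite:
  fixes E :: "complex set" and \<alpha> :: real
  assumes E: "E \<noteq> {}" "E \<subseteq> \<T>" and \<alpha>: "\<alpha> \<ge> 0" and I: "I_int \<alpha> E = \<infinity>"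
  shows "(\<integral>\<^sup>+z\<in>\<D>. ennreal ((1 - norm z) * infdist z E powr (- \<alpha> - 2)) \<partial>lborel) = \<infinity>"
proof -
  have [measurable]: "(\<lambda>z. infdist z E) \<in> borel_measurable borel" "cis \<in> borel_measurable borel"
    by (intro borel_measurable_continuous_onI continuous_intros)+
  let ?F = "\<lambda>z. ennreal ((1 - norm z) * infdist z E powr (- \<alpha> - 2)) * indicator \<D> z"
  define k where "k r = ennreal ((1 - r) * (2 * (1 - r)) powr (- \<alpha> - 2)) * ennreal (2 * pi * nu E (1 - r))" for r
  have [measurable]: "k \<in> borel_measurable borel" unfolding k_def by measurable
  have lower: "k (norm z) * indicator \<D> z \<le> (\<integral>\<^sup>+\<theta>\<in>{0..<2 * pi}. ?F (of_real (norm z) * cis \<theta>) \<partial>lborel)" for z :: complex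
  proof (cases "z \<in> \<D>")
    case True
    define s where "s = 1 - norm z"
    have s: "0 < s" "s \<le> 1" "norm z = 1 - s" using True by (auto simp: s_def)
    have pt: "ennreal (s * (2 * s) powr (- \<alpha> - 2)) * indicator {..<s} (infdist (cis \<theta>) E) \<le> ?F (of_real (1 - s) * cis \<theta>)" for \<theta>
    proof (cases "infdist (cis \<theta>) E < s")
      case close: True
      let ?w = "of_real (1 - s) * cis \<theta>"
      have nw: "norm ?w = 1 - s" using s by (simp add: norm_mult del: of_real_diff)
      have "?w - cis \<theta> = - of_real s * cis \<theta>" by (simp add: algebra_simps)
      then have "dist ?w (cis \<theta>) = s" using s by (simp add: dist_norm norm_mult)
      with infdist_triangle[of ?w E "cis \<theta>"] close have "infdist ?w E \<le> 2 * s" by simp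
      \<comment> \<open>Positivity matters because \<open>0 powr x\<close> is 0, so that negative
        powers decrease only on positive arguments.\<close>
      moreover have "0 < infdist ?w E"
      proof -
        have "s \<le> infdist ?w E" unfolding infdist_notempty[OF E(1)]
        proof (rule cINF_greatest[OF E(1)])
          fix \<zeta> assume "\<zeta> \<in> E"
          then show "s \<le> dist ?w \<zeta>"
            using E(2) norm_triangle_ineq2[of \<zeta> ?w] nw by (auto simp: dist_norm norm_minus_commute)
        qed
        with s show ?thesis by simp
      qed
      ultimately have "(2 * s) powr (- \<alpha> - 2) \<le> infdist ?w E powr (- \<alpha> - 2)"
        using \<alpha> by (intro powr_mono2') auto
      then have "ennreal (s * (2 * s) powr (- \<alpha> - 2)) \<le> ennreal ((1 - norm ?w) * infdist ?w E powr (- \<alpha> - 2))"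
        unfolding nw using s by (intro ennreal_leI) (simp add: mult_left_mono)
      moreover have "?w \<in> \<D>" using nw s by simp
      ultimately show ?thesis using close by (simp only: indicator_simps lessThan_iff mult_1_right)
    qed simp
    have "k (norm z) = ennreal (s * (2 * s) powr (- \<alpha> - 2)) * (\<integral>\<^sup>+\<theta>\<in>{0..<2 * pi}. indicator {..<s} (infdist (cis \<theta>) E) \<partial>lborel)"
      by (simp add: k_def s_def nu_eq_nn_integral)
    also have "\<dots> = (\<integral>\<^sup>+\<theta>\<in>{0..<2 * pi}. ennreal (s * (2 * s) powr (- \<alpha> - 2)) * indicator {..<s} (infdist (cis \<theta>) E) \<partial>lborel)"
      by (subst nn_integral_cmult[symmetric]) (auto simp: mult.assoc)
    also have "\<dots> \<le> (\<integral>\<^sup>+\<theta>\<in>{0..<2 * pi}. ?F (of_real (norm z) * cis \<theta>) \<partial>lborel)"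
      unfolding s(3) by (intro nn_integral_mono mult_right_mono pt) auto
    finally show ?thesis using True by simp
  qed simp
  \<comment> \<open>The constant collects 2 pi from the angular length,
    \<open>2 powr (- \<alpha> - 2)\<close> from the distance bound 2 s, and pi from 2 pi (1 - s)
    \<ge> pi.\<close>
  have "\<infinity> = ennreal (2 * pi\<^sup>2 * 2 powr (- \<alpha> - 2)) * (\<integral>\<^sup>+s\<in>{0<..1/2}. ennreal (nu E s / s powr (\<alpha> + 1)) \<partial>lborel)"
    unfolding I_int_near_0[OF \<alpha> I] by (simp add: ennreal_mult_top)
  also have "\<dots> = (\<integral>\<^sup>+s\<in>{0<..1/2}. ennreal (2 * pi\<^sup>2 * 2 powr (- \<alpha> - 2)) * ennreal (nu E s / s powr (\<alpha> + 1)) \<partial>lborel)"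
    by (subst nn_integral_cmult[symmetric]) (auto simp: mult.assoc)
  also have "\<dots> \<le> (\<integral>\<^sup>+s. ennreal (2 * pi * (1 - s)) * k (1 - s) * indicator {0..<1} (1 - s) \<partial>lborel)"
  proof (rule nn_integral_mono)
    fix s :: real
    show "ennreal (2 * pi\<^sup>2 * 2 powr (- \<alpha> - 2)) * ennreal (nu E s / s powr (\<alpha> + 1)) * indicator {0<..1/2} s
      \<le> ennreal (2 * pi * (1 - s)) * k (1 - s) * indicator {0..<1} (1 - s)"
    proof (cases "s \<in> {0<..1/2}")
      case True
      then have s: "0 < s" "s \<le> 1 / 2" by auto
      have pw: "s powr (- \<alpha> - 2) * s = 1 / s powr (\<alpha> + 1)"
      proof -
        have "s powr (- \<alpha> - 2) * s powr 1 = s powr (- (\<alpha> + 1))"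
          unfolding powr_add[symmetric] by (simp add: algebra_simps)
        also have "\<dots> = 1 / s powr (\<alpha> + 1)" by (rule powr_minus_divide)
        finally show ?thesis using s by simp
      qed
      have "2 * pi\<^sup>2 * 2 powr (- \<alpha> - 2) * (nu E s / s powr (\<alpha> + 1))
          = 2 * pi\<^sup>2 * 2 powr (- \<alpha> - 2) * (s powr (- \<alpha> - 2) * s) * nu E s"
        unfolding pw by simp
      also have "\<dots> = pi * (s * (2 * s) powr (- \<alpha> - 2) * (2 * pi * nu E s))"
        using s by (simp add: powr_mult power2_eq_square mult_ac)
      also have "\<dots> \<le> 2 * pi * (1 - s) * (s * (2 * s) powr (- \<alpha> - 2) * (2 * pi * nu E s))"
        using s nu_nonneg[of E s] by (intro mult_right_mono) auto
      finally show ?thesis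
        using s nu_nonneg[of E s] by (simp add: k_def ennreal_mult[symmetric] ennreal_leI)
    qed simp
  qed
  also have "\<dots> = (\<integral>\<^sup>+r\<in>{0..<1}. ennreal (2 * pi * r) * k r \<partial>lborel)"
    using nn_integral_real_affine[of "\<lambda>r. ennreal (2 * pi * r) * k r * indicator {0..<1} r" "- 1" 1] by simp
  also have "\<dots> = (\<integral>\<^sup>+z\<in>\<D>. k (norm z) \<partial>lborel)"
    by (rule nn_integral_radial[symmetric]) simp
  also have "\<dots> \<le> (\<integral>\<^sup>+z. (\<integral>\<^sup>+\<theta>\<in>{0..<2 * pi}. ?F (of_real (norm z) * cis \<theta>) \<partial>lborel) \<partial>(lborel :: complex measure))"
    by (intro nn_integral_mono lower)
  also have "\<dots> = ennreal (2 * pi) * (\<integral>\<^sup>+z. ?F z \<partial>lborel)"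
    by (rule nn_integral_circle_average[symmetric])
       (auto intro!: measurable_weight_on_ball continuous_intros)
  finally show ?thesis
    by (simp add: top_unique ennreal_mult_eq_top_iff)
qed

theorem theorem2:
  fixes E :: "complex set" and \<alpha> q :: real and \<mu>\<^sub>0 :: "complex measure"
  assumes "E \<noteq> {}" and "closed E" and "E \<subseteq> \<T>"
    and "\<alpha> \<ge> 0" and "I_int \<alpha> E = \<infinity>"
    and "q > 0" and "q \<ge> \<alpha>"
    and "is_Riesz_measure (\<lambda>z. infdist z E powr (- q)) \<mu>\<^sub>0"
  shows "(\<integral>\<^sup>+z. ennreal ((1 - norm z) * infdist z E powr (q - \<alpha>)) \<partial>\<mu>\<^sub>0) = \<infinity>"
proof -
  \<comment> \<open>Makes the weight continuous and positive on the disc, as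
    \<open>Riesz_measure_infdist_powr\<close> demands.\<close>
  have pos: "infdist z E > 0" if "z \<in> \<D>" for z
    using that assms(1-3) infdist_pos_not_in_closed[of E z] by force
  let ?f = "\<lambda>z. (1 - norm z) * infdist z E powr (q - \<alpha>)"
  have "continuous_on \<D> ?f"
    using pos by (intro continuous_intros) force
  moreover have "?f z > 0" if "z \<in> \<D>" for z
    using pos[OF that] that by simp
  ultimately have "ennreal (q\<^sup>2 * exp (- 1) / (8 * pi))
      * (\<integral>\<^sup>+z. ennreal (?f z * infdist z E powr (- q - 2)) * indicator \<D> z \<partial>lborel)
    \<le> (\<integral>\<^sup>+z. ennreal (?f z) \<partial>\<mu>\<^sub>0)"
    by (rule Riesz_measure_infdist_powr[OF assms(2,1,3,6,8)])
  \<comment> \<open>The exponents q - \<alpha> and - q - 2 add up to - \<alpha> - 2, so q drops out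
    of the area integral.\<close>
  moreover have "(\<integral>\<^sup>+z. ennreal (?f z * infdist z E powr (- q - 2)) * indicator \<D> z \<partial>lborel)
      = (\<integral>\<^sup>+z\<in>\<D>. ennreal ((1 - norm z) * infdist z E powr (- \<alpha> - 2)) \<partial>lborel)"
    using powr_add[of _ "q - \<alpha>" "- q - 2"] by (simp add: mult.assoc)
  ultimately show ?thesis
    using area_integral_infinite[OF assms(1,3,4,5)] assms(6) by (simp add: ennreal_mult_top top_unique)
qed

end
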